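(* Let $S=(\mu,\lambda,\bar\chi)$ be such that $\mu,\lambda$ are infinite cardinals with $\mu=\mu^{<\mu}<\mathrm{cf}(\lambda)<\lambda\leq 2^\mu$, and $\bar\chi=\langle\chi_i:i<\mathrm{cf}(\lambda)\rangle$ is a strictly increasing continuous sequence of cardinals such that $\chi_0=0$, $\mathrm{cf}(\lambda)<\chi_1$, $\mathrm{cf}(\chi_{i+1})=\chi_{i+1}$ for all $i$, and $\sup_{i<\mathrm{cf}(\lambda)}\chi_i=\lambda$. If $\mathbf{b}$ is a base for $S$, then \[\mathrm{hL}(\mathbb{B}^{\mathbf{b}})=\mathrm{hd}(\mathbb{B}^{\mathbf{b}})=s^+(\mathbb{B}^{\mathbf{b}})=\lambda .\] If additionally $\mathbf{b}$ is a base$^+$ for $S$, then also \[\mathrm{hL}_{(7)}^+(\mathbb{B}^{\mathbf{b}})=\mathrm{hd}_{(5)}^+(\mathbb{B}^{\mathbf{b}})=\lambda .\]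
   Context: $\mu^{\mu}$ and $\mu^{<\mu}$ (as sets) are the sets of sequences of ordinals below $\mu$ of length $\mu$ and of length $<\mu$, respectively; $<_{\mathrm{lex}}$ is the lexicographic order. For sequences $\eta,\nu$, $\eta\cap\nu$ denotes their longest common initial segment. For $\alpha<\lambda$ let $j(\alpha)<\mathrm{cf}(\lambda)$ be such that $\chi_{j(\alpha)}\leq\alpha<\chi_{j(\alpha)+1}$. A base for $S$ is a pair $(\bar\eta,A)$ such that: (a) $A\subseteq\mu^{<\mu}$ and $\bar\eta=\langle\eta_\alpha:\alpha<\lambda\rangle\subseteq\mu^\mu$; (b) if $\alpha<\beta<\lambda$ and $j(\alpha)=j(\beta)$, then $\eta_\alpha\cap\eta_\beta\notin A$; (c) if $Y\subseteq\lambda$, $|Y|=\lambda$, then there are distinct $\alpha,\beta\in Y$ with $\eta_\alpha\cap\eta_\beta\in A$. It is a base$^+$ for $S$ if it satisfies (a), (b) and (c$^+$) if $Y\subseteq\lambda$, $|Y|=\lambda$ and $\mathbf{t}\in\{0,1\}$, then there are $\alpha,\beta\in Y$ such that $\alpha<\beta$, $\eta_\alpha\cap\eta_\beta\in A$, and ($\eta_\alpha<_{\mathrm{lex}}\eta_\beta$ iff $\mathbf{t}=0$). For a set $w$ and $F\subseteq 2^w$ (functions from $w$ to $\{0,1\}$), $\mathbb{B}_{(w,F)}$ is the Boolean algebra generated freely by $\{x_\alpha:\alpha\in w\}$ except that: whenever $u_0,u_1\subseteq w$ are finite and there is no $f\in F$ with $f\restriction u_0\equiv 0$ and $f\restriction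 u_1\equiv 1$, then $\bigwedge_{\alpha\in u_1}x_\alpha\wedge\bigwedge_{\alpha\in u_0}(-x_\alpha)=0$. For a base $\mathbf{b}=(\bar\eta,A)$ for $S$ and $\alpha<\lambda$, $f^{\mathbf{b}}_\alpha:\lambda\to 2$ is defined by $f^{\mathbf{b}}_\alpha(\beta)=1$ if either $\alpha=\beta$, or $\alpha\neq\beta$, $\eta_\alpha\cap\eta_\beta\in A$ and $\eta_\alpha<_{\mathrm{lex}}\eta_\beta$; and $f^{\mathbf{b}}_\alpha(\beta)=0$ otherwise. Let $F^{\mathbf{b}}=\{f^{\mathbf{b}}_\alpha:\alpha<\lambda\}$ and $\mathbb{B}^{\mathbf{b}}=\mathbb{B}_{(\lambda,F^{\mathbf{b}})}$. A sequence $\langle a_\xi:\xi<\kappa\rangle$ in a Boolean algebra is ideal-independent (respectively left-separated, right-separated) if $a_\xi\nleq\bigvee_{\zeta\in w}a_\zeta$ for each $\xi<\kappa$ and each finite $w\subseteq\kappa\setminus\{\xi\}$ (respectively finite $w\subseteq\kappa\setminus(\xi+1)$, finite $w\subseteq\xi$). With $\kappa$ ranging over cardinals and $\kappa^+$ the cardinal successor: - $s^+(\mathbb{B})=\sup\{\kappa^+:\text{there is an ideal-independent sequence of length }\kappa\text{ in }\mathbb{B}\}$; - $\mathrm{hd}(\mathbb{B})=\sup\{\kappa:\ldots\}$ and $\mathrm{hd}_{(5)}^+(\mathbb{B})=\sup\{\kappa^+:\ldots\}$, where "$\ldots$" is: there is a left-separated sequence of length $\kappa$ in $\mathbb{B}$;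 - $\mathrm{hL}(\mathbb{B})=\sup\{\kappa:\ldots\}$ and $\mathrm{hL}_{(7)}^+(\mathbb{B})=\sup\{\kappa^+:\ldots\}$, where "$\ldots$" is: there is a right-separated sequence of length $\kappa$ in $\mathbb{B}$.
   Formalization: The sequences η_α (α<λ) of a base are required to be pairwise distinct; with repetitions, e.g. η_α depending only on j(α) and A=μ^{<μ}, clauses (a)–(c) hold but s^+ of the algebra is λ^+. *)

theory Defs
  imports
    Main
    "HOL-Library.Option_ord"
    "HOL-Library.Fun_Lexorder"
    "HOL-Library.Lub_Glb"
    "HOL-Algebra.Lattice"
begin

unbundle cardinal_syntax

section \<open>Ordinals\<close>

text \<open>
  Ordinals are the elements of an arbitrary type of class \<open>wellorder\<close>; the ordinal \<open>\<alpha>\<close> is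
  identified with its set of predecessors \<open>{..<\<alpha>}\<close>.  The theorem being polymorphic in the type,
  nothing is assumed about how far it extends.
\<close>

definition ord_zero :: "'a::wellorder"
  where "ord_zero = (LEAST \<alpha>. True)"

text \<open>Only meaningful when \<open>\<alpha>\<close> is not the last element of the type.\<close>
definition ord_succ :: "'a::wellorder \<Rightarrow> 'a"
  where "ord_succ \<alpha> = (LEAST \<beta>. \<alpha> < \<beta>)"

definition ord_limit :: "'a::wellorder \<Rightarrow> bool"
  where "ord_limit \<delta> \<longleftrightarrow> \<delta> \<noteq> ord_zero \<and> (\<forall>\<alpha><\<delta>. \<exists>\<beta><\<delta>. \<alpha> < \<beta>)"

definition is_cardinal :: "'a::wellorder \<Rightarrow> bool"
  where "is_cardinal \<kappa> \<longleftrightarrow> (\<forall>\<alpha><\<kappa>. |{..<\<alpha>}| <o |{..<\<kappa>}| )"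

definition cofinality :: "'a::wellorder \<Rightarrow> 'a"
  where "cofinality \<alpha> =
    (LEAST \<delta>. \<exists>f. f ` {..<\<delta>} \<subseteq> {..<\<alpha>} \<and> (\<forall>\<beta><\<alpha>. \<exists>\<xi><\<delta>. \<beta> \<le> f \<xi>))"


section \<open>Sequences of ordinals\<close>

text \<open>A sequence of length \<open>\<delta>\<close> is a partial function with domain \<open>{..<\<delta>}\<close>.\<close>

definition seqs_of_length :: "'a::wellorder \<Rightarrow> 'a \<Rightarrow> ('a \<rightharpoonup> 'a) set"
  where "seqs_of_length \<mu> \<delta> = {\<eta>. dom \<eta> = {..<\<delta>} \<and> ran \<eta> \<subseteq> {..<\<mu>}}"

definition seqs_shorter :: "'a::wellorder \<Rightarrow> 'a \<Rightarrow> ('a \<rightharpoonup> 'a) set"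
  where "seqs_shorter \<mu> \<delta> = (\<Union>\<gamma>\<in>{..<\<delta>}. seqs_of_length \<mu> \<gamma>)"

definition common_init :: "('a::wellorder \<rightharpoonup> 'a) \<Rightarrow> ('a \<rightharpoonup> 'a) \<Rightarrow> ('a \<rightharpoonup> 'a)"
  where "common_init \<eta> \<nu> = \<eta> |` {\<xi>. \<forall>\<zeta>\<le>\<xi>. \<eta> \<zeta> = \<nu> \<zeta>}"

text \<open>
  With \<open>None < Some a\<close>, the library's \<open>less_fun\<close> is the lexicographic order on sequences
  (a proper initial segment precedes its extensions).
\<close>
abbreviation lex_less :: "('a::wellorder \<rightharpoonup> 'a) \<Rightarrow> ('a \<rightharpoonup> 'a) \<Rightarrow> bool"
  where "lex_less \<eta> \<nu> \<equiv> less_fun \<eta> \<nu>"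


section \<open>Parameters and bases\<close>

definition good_parameter :: "'a::wellorder \<Rightarrow> 'a \<Rightarrow> ('a \<Rightarrow> 'a) \<Rightarrow> bool"
  where "good_parameter \<mu> \<Lambda> \<chi> \<longleftrightarrow>
    is_cardinal \<mu> \<and> infinite {..<\<mu>} \<and> is_cardinal \<Lambda> \<and> infinite {..<\<Lambda>} \<and>
    |{..<\<mu>}| =o |seqs_shorter \<mu> \<mu>| \<and>
    \<mu> < cofinality \<Lambda> \<and> cofinality \<Lambda> < \<Lambda> \<and>
    |{..<\<Lambda>}| \<le>o ctwo ^c |{..<\<mu>}| \<and>
    (\<forall>i<cofinality \<Lambda>. is_cardinal (\<chi> i)) \<and>
    strict_mono_on {..<cofinality \<Lambda>} \<chi> \<and>
    (\<forall>\<delta><cofinality \<Lambda>. ord_limit \<delta> \<longrightarrow> isLub UNIV (\<chi> ` {..<\<delta>}) (\<chi> \<delta>)) \<and>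
    \<chi> ord_zero = ord_zero \<and>
    cofinality \<Lambda> < \<chi> (ord_succ ord_zero) \<and>
    (\<forall>i<cofinality \<Lambda>. cofinality (\<chi> (ord_succ i)) = \<chi> (ord_succ i)) \<and>
    isLub UNIV (\<chi> ` {..<cofinality \<Lambda>}) \<Lambda>"

definition block :: "'a::wellorder \<Rightarrow> ('a \<Rightarrow> 'a) \<Rightarrow> 'a \<Rightarrow> 'a"
  where "block \<Lambda> \<chi> \<alpha> = (THE i. i < cofinality \<Lambda> \<and> \<chi> i \<le> \<alpha> \<and> \<alpha> < \<chi> (ord_succ i))"

text \<open>
  Clauses (a) and (b) of the definition of a base.  As usual for an indexed family of branches,
  the \<open>\<eta> \<alpha>\<close> are pairwise distinct: with repetitions allowed, \<open>\<eta> \<alpha> = \<eta> \<alpha>'\<close> for \<open>\<alpha> \<noteq> \<alpha>'\<close> would be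
  consistent with (b) and (c), and one would obtain \<open>\<Lambda>\<close> many pairwise disjoint nonzero elements
  \<open>x\<^sub>\<alpha> \<and> -x\<^sub>\<alpha>\<^sub>'\<close> in the associated algebra.
\<close>
definition prebase ::
    "'a::wellorder \<Rightarrow> 'a \<Rightarrow> ('a \<Rightarrow> 'a) \<Rightarrow> ('a \<Rightarrow> ('a \<rightharpoonup> 'a)) \<Rightarrow> ('a \<rightharpoonup> 'a) set \<Rightarrow> bool"
  where "prebase \<mu> \<Lambda> \<chi> \<eta> A \<longleftrightarrow>
    A \<subseteq> seqs_shorter \<mu> \<mu> \<and> \<eta> ` {..<\<Lambda>} \<subseteq> seqs_of_length \<mu> \<mu> \<and> inj_on \<eta> {..<\<Lambda>} \<and>
    (\<forall>\<alpha> \<beta>. \<alpha> < \<beta> \<and> \<beta> < \<Lambda> \<and> block \<Lambda> \<chi> \<alpha> = block \<Lambda> \<chi> \<beta> \<longrightarrow> common_init (\<eta> \<alpha>) (\<eta> \<beta>) \<notin> A)"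

definition base ::
    "'a::wellorder \<Rightarrow> 'a \<Rightarrow> ('a \<Rightarrow> 'a) \<Rightarrow> ('a \<Rightarrow> ('a \<rightharpoonup> 'a)) \<Rightarrow> ('a \<rightharpoonup> 'a) set \<Rightarrow> bool"
  where "base \<mu> \<Lambda> \<chi> \<eta> A \<longleftrightarrow> prebase \<mu> \<Lambda> \<chi> \<eta> A \<and>
    (\<forall>Y. Y \<subseteq> {..<\<Lambda>} \<and> |Y| =o |{..<\<Lambda>}| \<longrightarrow>
      (\<exists>\<alpha>\<in>Y. \<exists>\<beta>\<in>Y. \<alpha> \<noteq> \<beta> \<and> common_init (\<eta> \<alpha>) (\<eta> \<beta>) \<in> A))"

definition base_plus ::
    "'a::wellorder \<Rightarrow> 'a \<Rightarrow> ('a \<Rightarrow> 'a) \<Rightarrow> ('a \<Rightarrow> ('a \<rightharpoonup> 'a)) \<Rightarrow> ('a \<rightharpoonup> 'a) set \<Rightarrow> bool"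
  where "base_plus \<mu> \<Lambda> \<chi> \<eta> A \<longleftrightarrow> prebase \<mu> \<Lambda> \<chi> \<eta> A \<and>
    (\<forall>Y. \<forall>t\<in>{0, 1::nat}. Y \<subseteq> {..<\<Lambda>} \<and> |Y| =o |{..<\<Lambda>}| \<longrightarrow>
      (\<exists>\<alpha>\<in>Y. \<exists>\<beta>\<in>Y. \<alpha> < \<beta> \<and> common_init (\<eta> \<alpha>) (\<eta> \<beta>) \<in> A \<and>
        (lex_less (\<eta> \<alpha>) (\<eta> \<beta>) \<longleftrightarrow> t = 0)))"


section \<open>The Boolean algebra generated by \<open>w\<close> subject to the relations given by \<open>F\<close>\<close>

datatype 'a bterm =
  Gen 'a | Zero | One | Compl "'a bterm" | Meet "'a bterm" "'a bterm" | Join "'a bterm" "'a bterm"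

text \<open>
  The Boolean congruence on terms generated by the defining relations (rule \<open>relation\<close>); the
  axioms of Boolean algebras are those of \<open>abstract_boolean_algebra\<close>.  Elements of \<open>2\<^sup>w\<close> are
  represented by total predicates, of which only the values on \<open>w\<close> are used; the finite subsets
  of \<open>w\<close> are given by lists.
\<close>
inductive bequiv :: "'a set \<Rightarrow> ('a \<Rightarrow> bool) set \<Rightarrow> 'a bterm \<Rightarrow> 'a bterm \<Rightarrow> bool"
  for w :: "'a set" and F :: "('a \<Rightarrow> bool) set" where
  refl: "bequiv w F s s"
| sym: "bequiv w F s t \<Longrightarrow> bequiv w F t s"
| trans: "bequiv w F s t \<Longrightarrow> bequiv w F t u \<Longrightarrow> bequiv w F s u"
| compl_cong: "bequiv w F s s' \<Longrightarrow> bequiv w F (Compl s) (Compl s')"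
| meet_cong: "bequiv w F s s' \<Longrightarrow> bequiv w F t t' \<Longrightarrow> bequiv w F (Meet s t) (Meet s' t')"
| join_cong: "bequiv w F s s' \<Longrightarrow> bequiv w F t t' \<Longrightarrow> bequiv w F (Join s t) (Join s' t')"
| meet_assoc: "bequiv w F (Meet (Meet s t) u) (Meet s (Meet t u))"
| meet_commute: "bequiv w F (Meet s t) (Meet t s)"
| join_assoc: "bequiv w F (Join (Join s t) u) (Join s (Join t u))"
| join_commute: "bequiv w F (Join s t) (Join t s)"
| meet_join_distrib: "bequiv w F (Meet s (Join t u)) (Join (Meet s t) (Meet s u))"
| join_meet_distrib: "bequiv w F (Join s (Meet t u)) (Meet (Join s t) (Join s u))"
| meet_one: "bequiv w F (Meet s One) s"
| join_zero: "bequiv w F (Join s Zero) s"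
| meet_compl: "bequiv w F (Meet s (Compl s)) Zero"
| join_compl: "bequiv w F (Join s (Compl s)) One"
| relation: "set u0 \<subseteq> w \<Longrightarrow> set u1 \<subseteq> w \<Longrightarrow>
    \<not> (\<exists>f\<in>F. (\<forall>\<alpha>\<in>set u0. \<not> f \<alpha>) \<and> (\<forall>\<alpha>\<in>set u1. f \<alpha>)) \<Longrightarrow>
    bequiv w F (foldr Meet (map Gen u1 @ map (\<lambda>\<alpha>. Compl (Gen \<alpha>)) u0) One) Zero"

definition bterms :: "'a set \<Rightarrow> 'a bterm set"
  where "bterms w = {t. set_bterm t \<subseteq> w}"

definition bequiv_rel :: "'a set \<Rightarrow> ('a \<Rightarrow> bool) set \<Rightarrow> 'a bterm rel"
  where "bequiv_rel w F = {(s, t). s \<in> bterms w \<and> t \<in> bterms w \<and> bequiv w F s t}"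

text \<open>
  A Boolean algebra is given by its order, so that its finite joins are the \<open>\<Squnion>\<close> of
  \<open>HOL-Algebra.Lattice\<close>.
\<close>
definition presented_ba :: "'a set \<Rightarrow> ('a \<Rightarrow> bool) set \<Rightarrow> 'a bterm set gorder"
  where "presented_ba w F =
    \<lparr> carrier = bterms w // bequiv_rel w F,
      eq = (=),
      le = (\<lambda>X Y. \<exists>s\<in>X. \<exists>t\<in>Y. bequiv w F (Meet s t) s) \<rparr>"

text \<open>The order of \<^term>\<open>presented_ba w F\<close> is the Boolean one; finite joins are the expected ones.\<close>

context
  fixes w :: "'a set" and F :: "('a \<Rightarrow> bool) set"
begin

lemmas bequiv_trans [trans] = bequiv.trans[of w F]

lemma bequiv_meet_zero: "bequiv w F (Meet s Zero) Zero"
proof -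
  have "bequiv w F (Meet s Zero) (Join (Meet s Zero) Zero)"
    by (rule bequiv.sym) (rule bequiv.join_zero)
  also have "bequiv w F \<dots> (Join (Meet s Zero) (Meet s (Compl s)))"
    by (rule bequiv.join_cong[OF bequiv.refl bequiv.sym[OF bequiv.meet_compl]])
  also have "bequiv w F \<dots> (Meet s (Join Zero (Compl s)))"
    by (rule bequiv.sym) (rule bequiv.meet_join_distrib)
  also have "bequiv w F \<dots> (Meet s (Join (Compl s) Zero))"
    by (rule bequiv.meet_cong[OF bequiv.refl bequiv.join_commute])
  also have "bequiv w F \<dots> (Meet s (Compl s))"
    by (rule bequiv.meet_cong[OF bequiv.refl bequiv.join_zero])
  also have "bequiv w F \<dots> Zero"
    by (rule bequiv.meet_compl)
  finally show ?thesis .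
qed

lemma bequiv_zero_meet: "bequiv w F (Meet Zero s) Zero"
  by (rule bequiv.trans[OF bequiv.meet_commute bequiv_meet_zero])

lemma bequiv_absorb: "bequiv w F (Meet s (Join s t)) s"
proof -
  have "bequiv w F (Meet s (Join s t)) (Meet (Join s Zero) (Join s t))"
    by (rule bequiv.meet_cong[OF bequiv.sym[OF bequiv.join_zero] bequiv.refl])
  also have "bequiv w F \<dots> (Join s (Meet Zero t))"
    by (rule bequiv.sym) (rule bequiv.join_meet_distrib)
  also have "bequiv w F \<dots> (Join s Zero)"
    by (rule bequiv.join_cong[OF bequiv.refl bequiv_zero_meet])
  also have "bequiv w F \<dots> s"
    by (rule bequiv.join_zero)
  finally show ?thesis .
qed

lemma bequiv_absorb': "bequiv w F (Meet t (Join s t)) t"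
  by (rule bequiv.trans[OF bequiv.meet_cong[OF bequiv.refl bequiv.join_commute] bequiv_absorb])

lemma bequiv_meet_idem: "bequiv w F (Meet s s) s"
  by (rule bequiv.trans[OF bequiv.meet_cong[OF bequiv.refl bequiv.sym[OF bequiv.join_zero]]
        bequiv_absorb])

lemma bequiv_le_trans:
  assumes st: "bequiv w F (Meet s t) s" and tu: "bequiv w F (Meet t u) t"
  shows "bequiv w F (Meet s u) s"
proof -
  have "bequiv w F (Meet s u) (Meet (Meet s t) u)"
    by (rule bequiv.meet_cong[OF bequiv.sym[OF st] bequiv.refl])
  also have "bequiv w F \<dots> (Meet s (Meet t u))"
    by (rule bequiv.meet_assoc)
  also have "bequiv w F \<dots> (Meet s t)"
    by (rule bequiv.meet_cong[OF bequiv.refl tu])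
  also note st
  finally show ?thesis .
qed

lemma bequiv_le_joinI:
  assumes s: "bequiv w F (Meet s u) s" and t: "bequiv w F (Meet t u) t"
  shows "bequiv w F (Meet (Join s t) u) (Join s t)"
proof -
  have "bequiv w F (Meet (Join s t) u) (Meet u (Join s t))" by (rule bequiv.meet_commute)
  also have "bequiv w F \<dots> (Join (Meet u s) (Meet u t))"
    by (rule bequiv.meet_join_distrib)
  also have "bequiv w F \<dots> (Join (Meet s u) (Meet t u))"
    by (rule bequiv.join_cong[OF bequiv.meet_commute bequiv.meet_commute])
  also have "bequiv w F \<dots> (Join s t)"
    by (rule bequiv.join_cong[OF s t])
  finally show ?thesis .
qed

end

lemma bequiv_rel_equiv: "equiv (bterms w) (bequiv_rel w F)"
proof (rule equivI)
  show "bequiv_rel w F \<subseteq> bterms w \<times> bterms w" by (auto simp: bequiv_rel_def)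
  show "refl_on (bterms w) (bequiv_rel w F)"
    by (auto simp: refl_on_def bequiv_rel_def bequiv.refl)
  show "sym_on UNIV (bequiv_rel w F)" by (auto simp: sym_def bequiv_rel_def intro: bequiv.sym)
  show "trans_on UNIV (bequiv_rel w F)" by (auto simp: trans_def bequiv_rel_def elim: bequiv.trans)
qed

lemma presented_ba_carrier:
  "X \<in> carrier (presented_ba w F) \<longleftrightarrow> (\<exists>t\<in>bterms w. X = bequiv_rel w F `` {t})"
  by (auto simp: presented_ba_def quotient_def)

lemma presented_ba_le:
  assumes "s \<in> bterms w" "t \<in> bterms w"
  shows "bequiv_rel w F `` {s} \<sqsubseteq>\<^bsub>presented_ba w F\<^esub> bequiv_rel w F `` {t} \<longleftrightarrow> bequiv w F (Meet s t) s"
proof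
  assume "bequiv_rel w F `` {s} \<sqsubseteq>\<^bsub>presented_ba w F\<^esub> bequiv_rel w F `` {t}"
  then obtain s' t' where *: "bequiv w F s s'" "bequiv w F t t'" "bequiv w F (Meet s' t') s'"
    by (auto simp: presented_ba_def bequiv_rel_def)
  show "bequiv w F (Meet s t) s"
    by (rule bequiv.trans[OF bequiv.meet_cong[OF *(1,2)] bequiv.trans[OF *(3) bequiv.sym[OF *(1)]]])
next
  assume "bequiv w F (Meet s t) s"
  with assms show "bequiv_rel w F `` {s} \<sqsubseteq>\<^bsub>presented_ba w F\<^esub> bequiv_rel w F `` {t}"
    by (auto simp: presented_ba_def bequiv_rel_def intro!: bexI[of _ s] bexI[of _ t] bequiv.refl)
qed

lemma presented_ba_partial_order: "partial_order (presented_ba w F)"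
proof
  let ?L = "presented_ba w F"
  fix X Y Z assume X: "X \<in> carrier ?L" and Y: "Y \<in> carrier ?L"
  then obtain s t where st: "s \<in> bterms w" "t \<in> bterms w"
    "X = bequiv_rel w F `` {s}" "Y = bequiv_rel w F `` {t}"
    by (auto simp: presented_ba_carrier)
  show "X \<sqsubseteq>\<^bsub>?L\<^esub> X" using st by (simp add: presented_ba_le bequiv_meet_idem)
  { assume "X \<sqsubseteq>\<^bsub>?L\<^esub> Y" "Y \<sqsubseteq>\<^bsub>?L\<^esub> X"
    then have "bequiv w F (Meet s t) s" "bequiv w F (Meet t s) t"
      using st by (simp_all add: presented_ba_le)
    then have "bequiv w F s t"
      by (rule bequiv.trans[OF bequiv.sym bequiv.trans[OF bequiv.meet_commute]])
    then have "(s, t) \<in> bequiv_rel w F" using st by (simp add: bequiv_rel_def)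
    then have "X = Y" using st equiv_class_eq[OF bequiv_rel_equiv] by metis
    then show "X .=\<^bsub>?L\<^esub> Y" by (simp add: presented_ba_def) }
  { assume "Z \<in> carrier ?L" "X \<sqsubseteq>\<^bsub>?L\<^esub> Y" "Y \<sqsubseteq>\<^bsub>?L\<^esub> Z"
    then show "X \<sqsubseteq>\<^bsub>?L\<^esub> Z"
      using st bequiv_le_trans by (auto simp: presented_ba_carrier presented_ba_le) }
qed (auto simp: presented_ba_def)

lemma presented_ba_finite_join:
  assumes "set ts \<subseteq> bterms w"
  shows "\<Squnion>\<^bsub>presented_ba w F\<^esub> ((\<lambda>t. bequiv_rel w F `` {t}) ` set ts) =
    bequiv_rel w F `` {foldr Join ts Zero}"
proof -
  let ?L = "presented_ba w F" and ?c = "\<lambda>t. bequiv_rel w F `` {t}"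
  interpret partial_order ?L by (rule presented_ba_partial_order)
  have T: "foldr Join ts Zero \<in> bterms w"
    using assms by (induction ts) (auto simp: bterms_def)
  have ub: "bequiv w F (Meet t (foldr Join ts Zero)) t" if "t \<in> set ts" for t
    using that
  proof (induction ts)
    case (Cons a ts)
    then show ?case
      by (auto intro: bequiv_absorb bequiv_le_trans[OF _ bequiv_absorb'])
  qed simp
  have lub: "bequiv w F (Meet (foldr Join ts Zero) u) (foldr Join ts Zero)"
    if "\<And>t. t \<in> set ts \<Longrightarrow> bequiv w F (Meet t u) t" for u
    using that
  proof (induction ts)
    case Nil
    then show ?case by (simp add: bequiv_zero_meet)
  qed (auto intro: bequiv_le_joinI)
  have L: "least ?L (?c (foldr Join ts Zero)) (Upper ?L (?c ` set ts))"
  proof (rule least_UpperI)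
    show "?c ` set ts \<subseteq> carrier ?L"
      using assms by (force simp: presented_ba_carrier)
    show "?c (foldr Join ts Zero) \<in> carrier ?L"
      using T by (auto simp: presented_ba_carrier)
  next
    fix X assume "X \<in> ?c ` set ts"
    then show "X \<sqsubseteq>\<^bsub>?L\<^esub> ?c (foldr Join ts Zero)"
      using assms T ub by (auto simp: presented_ba_le subset_iff)
  next
    fix Y assume Y: "Y \<in> Upper ?L (?c ` set ts)"
    then obtain u where u: "u \<in> bterms w" "Y = ?c u"
      by (auto simp: Upper_def presented_ba_carrier)
    have "bequiv w F (Meet t u) t" if "t \<in> set ts" for t
    proof -
      have "t \<in> bterms w" using assms that by blast
      moreover from this have "?c t \<in> carrier ?L" by (auto simp: presented_ba_carrier)
      then have "?c t \<sqsubseteq>\<^bsub>?L\<^esub> Y" using Y that by (auto simp: Upper_def)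
      ultimately show ?thesis using u by (simp add: presented_ba_le)
    qed
    then show "?c (foldr Join ts Zero) \<sqsubseteq>\<^bsub>?L\<^esub> Y"
      using lub u T by (simp add: presented_ba_le)
  qed
  show ?thesis
    unfolding Lattice.sup_def using L least_unique by (intro some_equality)
qed

definition base_fun ::
    "('a::wellorder \<Rightarrow> ('a \<rightharpoonup> 'a)) \<Rightarrow> ('a \<rightharpoonup> 'a) set \<Rightarrow> 'a \<Rightarrow> 'a \<Rightarrow> bool"
  where "base_fun \<eta> A \<alpha> \<beta> \<longleftrightarrow>
    \<alpha> = \<beta> \<or> (\<alpha> \<noteq> \<beta> \<and> common_init (\<eta> \<alpha>) (\<eta> \<beta>) \<in> A \<and> lex_less (\<eta> \<alpha>) (\<eta> \<beta>))"

definition base_algebra ::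
    "'a::wellorder \<Rightarrow> ('a \<Rightarrow> ('a \<rightharpoonup> 'a)) \<Rightarrow> ('a \<rightharpoonup> 'a) set \<Rightarrow> 'a bterm set gorder"
  where "base_algebra \<Lambda> \<eta> A = presented_ba {..<\<Lambda>} (base_fun \<eta> A ` {..<\<Lambda>})"


section \<open>Cardinal invariants of Boolean algebras\<close>

text \<open>
  Sequences of length \<open>\<kappa>\<close> are functions on the field of a well-order \<open>\<kappa>\<close>; then
  \<open>aboveS \<kappa> \<xi>\<close> is \<open>\<kappa> \<setminus> (\<xi> + 1)\<close> and \<open>underS \<kappa> \<xi>\<close> is \<open>\<xi>\<close>.
\<close>

definition ideal_independent :: "('b, 'm) gorder_scheme \<Rightarrow> 'k rel \<Rightarrow> ('k \<Rightarrow> 'b) \<Rightarrow> bool"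
  where "ideal_independent L \<kappa> a \<longleftrightarrow> a ` Field \<kappa> \<subseteq> carrier L \<and>
    (\<forall>\<xi>\<in>Field \<kappa>. \<forall>w. finite w \<and> w \<subseteq> Field \<kappa> - {\<xi>} \<longrightarrow> \<not> a \<xi> \<sqsubseteq>\<^bsub>L\<^esub> \<Squnion>\<^bsub>L\<^esub>(a ` w))"

definition left_separated :: "('b, 'm) gorder_scheme \<Rightarrow> 'k rel \<Rightarrow> ('k \<Rightarrow> 'b) \<Rightarrow> bool"
  where "left_separated L \<kappa> a \<longleftrightarrow> a ` Field \<kappa> \<subseteq> carrier L \<and>
    (\<forall>\<xi>\<in>Field \<kappa>. \<forall>w. finite w \<and> w \<subseteq> aboveS \<kappa> \<xi> \<longrightarrow> \<not> a \<xi> \<sqsubseteq>\<^bsub>L\<^esub> \<Squnion>\<^bsub>L\<^esub>(a ` w))"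

definition right_separated :: "('b, 'm) gorder_scheme \<Rightarrow> 'k rel \<Rightarrow> ('k \<Rightarrow> 'b) \<Rightarrow> bool"
  where "right_separated L \<kappa> a \<longleftrightarrow> a ` Field \<kappa> \<subseteq> carrier L \<and>
    (\<forall>\<xi>\<in>Field \<kappa>. \<forall>w. finite w \<and> w \<subseteq> underS \<kappa> \<xi> \<longrightarrow> \<not> a \<xi> \<sqsubseteq>\<^bsub>L\<^esub> \<Squnion>\<^bsub>L\<^esub>(a ` w))"

text \<open>
  The supremum of a set of cardinals on a common type, determined up to \<open>=o\<close>; it always exists
  on that type (lemma \<open>card_Sup\<close> below).
\<close>
definition is_card_Sup :: "'c rel set \<Rightarrow> 'c rel \<Rightarrow> bool"
  where "is_card_Sup K s \<longleftrightarrow> Card_order s \<and> (\<forall>\<kappa>\<in>K. \<kappa> \<le>o s) \<and>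
    (\<forall>t::'c rel. Card_order t \<and> (\<forall>\<kappa>\<in>K. \<kappa> \<le>o t) \<longrightarrow> s \<le>o t)"

definition card_Sup :: "'c rel set \<Rightarrow> 'c rel"
  where "card_Sup K = (SOME s. is_card_Sup K s)"

lemma card_Sup:
  fixes K :: "'c rel set"
  assumes "\<And>\<kappa>. \<kappa> \<in> K \<Longrightarrow> Card_order \<kappa>"
  shows "is_card_Sup K (card_Sup K)"
proof -
  let ?U = "{s :: 'c rel. Card_order s \<and> (\<forall>\<kappa>\<in>K. \<kappa> \<le>o s)}"
  have "\<kappa> \<le>o |UNIV :: 'c set|" if "\<kappa> \<in> K" for \<kappa>
    using assms[OF that] card_of_Field_ordIso[of \<kappa>] card_of_mono1[of "Field \<kappa>" UNIV]
      ordIso_symmetric ordIso_ordLeq_trans by blast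
  then have "|UNIV :: 'c set| \<in> ?U"
    by (simp add: card_of_Card_order)
  then obtain s where s: "s \<in> ?U" "\<forall>t\<in>?U. s \<le>o t"
    using exists_minim_Card_order[of ?U] by blast
  then have "is_card_Sup K s"
    unfolding is_card_Sup_def using s by simp
  then show ?thesis
    unfolding card_Sup_def by (rule someI)
qed

text \<open>
  In each of the following suprema \<open>\<kappa>\<close> ranges over the cardinals on the type of elements of the
  algebra.  This covers all cardinals: the sequences in question are injective, so the length of
  any of them is equipotent to a subset of that type.
\<close>

definition s_plus :: "('b, 'm) gorder_scheme \<Rightarrow> 'b set rel"
  where "s_plus L =
    card_Sup {cardSuc \<kappa> |\<kappa> :: 'b rel. Card_order \<kappa> \<and> (\<exists>a. ideal_independent L \<kappa> a)}"

definition hd_inv :: "('b, 'm) gorder_scheme \<Rightarrow> 'b rel"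
  where "hd_inv L = card_Sup {\<kappa> :: 'b rel. Card_order \<kappa> \<and> (\<exists>a. left_separated L \<kappa> a)}"

definition hd5_plus :: "('b, 'm) gorder_scheme \<Rightarrow> 'b set rel"
  where "hd5_plus L =
    card_Sup {cardSuc \<kappa> |\<kappa> :: 'b rel. Card_order \<kappa> \<and> (\<exists>a. left_separated L \<kappa> a)}"

definition hL_inv :: "('b, 'm) gorder_scheme \<Rightarrow> 'b rel"
  where "hL_inv L = card_Sup {\<kappa> :: 'b rel. Card_order \<kappa> \<and> (\<exists>a. right_separated L \<kappa> a)}"

definition hL7_plus :: "('b, 'm) gorder_scheme \<Rightarrow> 'b set rel"
  where "hL7_plus L =
    card_Sup {cardSuc \<kappa> |\<kappa> :: 'b rel. Card_order \<kappa> \<and> (\<exists>a. right_separated L \<kappa> a)}"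

end

theory Submission
  imports Defs "HOL-Algebra.Free_Abelian_Groups"
begin

text \<open>
  Write \<open>\<alpha> \<preceq> \<beta>\<close> for \<open>base_fun \<eta> A \<alpha> \<beta>\<close>: either \<open>\<alpha> = \<beta>\<close>, or the branches \<open>\<eta> \<alpha>\<close> and \<open>\<eta> \<beta>\<close> part at
  a node in \<open>A\<close>, where \<open>\<eta> \<alpha>\<close> turns left.  This is a transitive relation (\<open>base_fun_trans\<close>), because
  of three branches the outer two part at the lower one of the other two parting nodes.  Hence the
  functions defining the algebra are the indicators of the principal up-sets of \<open>\<preceq>\<close>.  By
  completeness of Boolean reasoning (\<open>presented_ba_le_join_iff\<close>), an element fails to lie below a
  finite join exactly if one of these functions satisfies the element and no member of the join.

  \<^emph>\<open>Long sequences.\<close> By clause (b), different indices of one block are not related by \<open>\<preceq>\<close>, so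
  the function of \<open>\<alpha>\<close> satisfies no generator of its block but \<open>x\<^sub>\<alpha>\<close>.  The generators of a block are
  therefore ideal-independent (\<open>block_ideal_independent\<close>), and since block \<open>i\<close> has at least \<open>\<chi> i\<close>
  elements, all the suprema are at least \<open>\<Lambda>\<close>.  As the algebra has at most \<open>\<Lambda>\<close> elements, this
  determines hL and hd.

  \<^emph>\<open>No sequence of length \<open>\<Lambda>\<close>.\<close> The core is \<open>separated_generators\<close>: a separated sequence of
  length \<open>\<Lambda>\<close> can be replaced by \<open>\<Lambda>\<close> many generators, or \<open>\<Lambda>\<close> many complements of generators, that
  are separated in the same sense.  Each term is first replaced by a conjunction of finitely many
  generators and complements.  Since \<open>\<mu>\<^sup><\<^sup>\<mu> = \<mu> < cf \<Lambda>\<close>, we may assume that all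
  these conjunctions look the same below some \<open>\<gamma> < \<mu>\<close>, where their finitely many branches are
  already apart.  A function \<open>base_fun \<eta> A \<alpha>\<close> can then distinguish two of the conjunctions only
  in the one coordinate whose initial segment \<open>\<eta> \<alpha>\<close> extends, so for \<open>\<Lambda>\<close> many indices a single fixed
  coordinate does all the separating.

  Separated generators are unrelated under \<open>\<preceq>\<close>, in both directions if the sequence is
  ideal-independent, and in one direction depending on the order of the indices if it is left- or
  right-separated.  The former contradicts clause (c) of a base.  In the latter case the order
  of the indices has to be matched with the order of the ordinals naming the generators, and this is
  possible for pairs in different blocks on a set of size \<open>\<Lambda>\<close> (\<open>increasing_across_blocks\<close>);
  related pairs do lie in different blocks, so clause (c\<open>\<^sup>+\<close>), for the suitable
  direction, gives the contradiction.
\<close>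


section \<open>Cardinals as initial segments\<close>

lemma ord_zero_le: "ord_zero \<le> \<alpha>"
  unfolding ord_zero_def by (rule Least_le) simp

lemma ord_succ_le: "\<alpha> < \<beta> \<Longrightarrow> ord_succ \<alpha> \<le> \<beta>"
  unfolding ord_succ_def by (rule Least_le)

lemma less_ord_succ: "\<alpha> < \<beta> \<Longrightarrow> \<alpha> < ord_succ \<alpha>"
  unfolding ord_succ_def by (rule LeastI)

lemma card_lessThan_mono: "\<alpha> \<le> \<beta> \<Longrightarrow> |{..<\<alpha>}| \<le>o |{..<\<beta>}|" for \<alpha> :: "'a::wellorder"
  by (rule card_of_mono1) auto

lemma wf_less_wellorder: "wf {(x :: 'a::wellorder, y). x < y}"
  using wfp_on_less[of UNIV] unfolding wfp_def .

lemma cardinal_not_ordLeq: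
  assumes "is_cardinal \<kappa>" "\<alpha> < \<kappa>"
  shows "\<not> |{..<\<kappa>}| \<le>o |{..<\<alpha>}|"
  using assms not_ordLess_ordLeq unfolding is_cardinal_def by blast

text \<open>
  The ordinal \<open>\<kappa>\<close> as a relation, which is the form in which the library compares lengths of
  well-orders.
\<close>
definition below_order :: "'a::wellorder \<Rightarrow> 'a rel"
  where "below_order \<kappa> = {(\<alpha>, \<beta>). \<alpha> \<le> \<beta> \<and> \<beta> < \<kappa>}"

lemma Field_below_order: "Field (below_order \<kappa>) = {..<\<kappa>}"
  by (auto simp: Field_def below_order_def)

lemma underS_below_order: "\<alpha> < \<kappa> \<Longrightarrow> underS (below_order \<kappa>) \<alpha> = {..<\<alpha>}"
  by (auto simp: underS_def below_order_def)

lemma Restr_below_order: "\<alpha> < \<kappa> \<Longrightarrow> Restr (below_order \<kappa>) {..<\<alpha>} = below_order \<alpha>"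
  by (auto simp: below_order_def)

lemma Well_order_below_order: "Well_order (below_order \<kappa>)"
proof -
  have "wf (below_order \<kappa> - Id)"
    by (rule wf_subset[OF wf_less_wellorder]) (auto simp: below_order_def)
  moreover have "refl_on {..<\<kappa>} (below_order \<kappa>)" "trans (below_order \<kappa>)"
    "antisym (below_order \<kappa>)" "total_on {..<\<kappa>} (below_order \<kappa>)"
    by (auto simp: below_order_def refl_on_def trans_def antisym_def total_on_def)
  moreover have "below_order \<kappa> \<subseteq> {..<\<kappa>} \<times> {..<\<kappa>}"
    by (auto simp: below_order_def)
  ultimately show ?thesis
    unfolding well_order_on_def linear_order_on_def partial_order_on_def preorder_on_def
      Field_below_order by blast
qed

lemma Card_order_below_order:
  assumes "is_cardinal \<kappa>"
  shows "Card_order (below_order \<kappa>)"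
proof -
  have "below_order \<alpha> <o |{..<\<kappa>}|" if "\<alpha> < \<kappa>" for \<alpha>
  proof (rule ccontr)
    assume "\<not> below_order \<alpha> <o |{..<\<kappa>}|"
    then have "|{..<\<kappa>}| \<le>o below_order \<alpha>"
      by (simp add: not_ordLess_iff_ordLeq Well_order_below_order)
    from card_of_mono2[OF this] have "|{..<\<kappa>}| \<le>o |{..<\<alpha>}|"
      by (simp add: Field_below_order)
    then show False
      using assms that using cardinal_not_ordLeq by blast
  qed
  then show ?thesis
    unfolding Card_order_iff_Restr_underS[OF Well_order_below_order]
    by (simp add: Field_below_order underS_below_order Restr_below_order)
qed

lemma below_order_ordIso: "is_cardinal \<kappa> \<Longrightarrow> below_order \<kappa> =o |{..<\<kappa>}|"
  using Card_order_below_order[of \<kappa>] card_of_Field_ordIso[of "below_order \<kappa>"] ordIso_symmetric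
  by (simp add: Field_below_order)

lemma ordLess_cardinalE:
  assumes "is_cardinal \<kappa>" "r <o |{..<\<kappa>}|"
  obtains \<alpha> where "\<alpha> < \<kappa>" "r =o below_order \<alpha>"
proof -
  have "r <o below_order \<kappa>"
    by (rule ordLess_ordIso_trans[OF assms(2) ordIso_symmetric[OF below_order_ordIso[OF assms(1)]]])
  moreover have "Well_order r"
    using assms(2) unfolding ordLess_def by blast
  ultimately obtain \<alpha> where "\<alpha> \<in> Field (below_order \<kappa>)"
    "r =o Restr (below_order \<kappa>) (underS (below_order \<kappa>) \<alpha>)"
    using ordLess_iff_ordIso_Restr[OF Well_order_below_order] by blast
  then show thesis
    using that by (simp add: Field_below_order underS_below_order Restr_below_order)
qed

lemma card_of_ordLess_cardinalE:
  assumes "is_cardinal \<kappa>" "|X| <o |{..<\<kappa>}|"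
  obtains \<alpha> where "\<alpha> < \<kappa>" "|X| \<le>o |{..<\<alpha>}|"
proof -
  obtain \<alpha> where \<alpha>: "\<alpha> < \<kappa>" "|X| =o below_order \<alpha>"
    using ordLess_cardinalE[OF assms] .
  have "|X| \<le>o |{..<\<alpha>}|"
    using card_of_mono2[OF ordIso_imp_ordLeq[OF \<alpha>(2)]]
    by (simp add: Field_below_order)
  with \<alpha> that show thesis by blast
qed

text \<open>
  A cardinal embeds order-preservingly into every well-order that is at least as long; this turns
  sequences indexed by an abstract cardinal into sequences indexed by ordinals.
\<close>
lemma cardinal_embedding:
  assumes "is_cardinal \<kappa>" "|{..<\<kappa>}| \<le>o r"
  obtains h where "h ` {..<\<kappa>} \<subseteq> Field r"
    and "\<forall>\<zeta><\<kappa>. \<forall>\<xi><\<zeta>. h \<xi> \<noteq> h \<zeta> \<and> (h \<xi>, h \<zeta>) \<in> r"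
proof -
  have "below_order \<kappa> \<le>o r"
    by (rule ordIso_ordLeq_trans[OF below_order_ordIso[OF assms(1)] assms(2)])
  then obtain h where h: "embed (below_order \<kappa>) r h"
    unfolding ordLeq_def by blast
  have inj: "inj_on h {..<\<kappa>}"
    using embed_inj_on[OF Well_order_below_order h] by (simp add: Field_below_order)
  have "compat (below_order \<kappa>) r h"
    by (rule embed_compat[OF h])
  then have "(h \<xi>, h \<zeta>) \<in> r" if "\<xi> < \<zeta>" "\<zeta> < \<kappa>" for \<xi> \<zeta>
    using that by (auto simp: compat_def below_order_def)
  moreover have "h \<xi> \<noteq> h \<zeta>" if "\<xi> < \<zeta>" "\<zeta> < \<kappa>" for \<xi> \<zeta>
    using that inj by (auto dest: inj_onD)
  moreover have "h ` {..<\<kappa>} \<subseteq> Field r"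
    using embed_Field[OF h] by (simp add: Field_below_order)
  ultimately show thesis using that by blast
qed

text \<open>Adding one element to an infinite set does not change its size.\<close>
lemma infinite_cardinal_limit:
  assumes "is_cardinal \<kappa>" "infinite {..<\<kappa>}" "\<alpha> < \<kappa>"
  shows "\<exists>\<beta><\<kappa>. \<alpha> < \<beta>"
proof (rule ccontr)
  assume "\<not> ?thesis"
  then have "\<beta> \<le> \<alpha>" if "\<beta> < \<kappa>" for \<beta> using that leI by blast
  then have sub: "{..<\<kappa>} \<subseteq> {..<\<alpha>} \<union> {\<alpha>}" by (force simp: le_less)
  then have inf: "infinite {..<\<alpha>}" using assms(2) finite_subset by fastforce
  obtain h where "bij_betw h {..<\<alpha>} ({..<\<alpha>} \<union> {\<alpha>})"
    using infinite_imp_bij_betw2[OF inf, of \<alpha>] by blast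
  then have "|{..<\<alpha>} \<union> {\<alpha>}| \<le>o |{..<\<alpha>}|"
    by (rule ordIso_imp_ordLeq[OF ordIso_symmetric[OF card_of_ordIsoI]])
  then have "|{..<\<kappa>}| \<le>o |{..<\<alpha>}|"
    by (rule ordLeq_transitive[OF card_of_mono1[OF sub]])
  with cardinal_not_ordLeq assms show False by blast
qed


section \<open>The blocks below the singular cardinal\<close>

locale parameter =
  fixes \<mu> \<Lambda> :: "'a::wellorder" and \<chi> :: "'a \<Rightarrow> 'a"
  assumes good: "good_parameter \<mu> \<Lambda> \<chi>"
begin

abbreviation \<theta> :: 'a where "\<theta> \<equiv> cofinality \<Lambda>"

lemma mu_infinite: "infinite {..<\<mu>}"
  and Lambda_cardinal: "is_cardinal \<Lambda>"
  and Lambda_infinite: "infinite {..<\<Lambda>}"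
  and card_seqs_shorter: "|seqs_shorter \<mu> \<mu>| \<le>o |{..<\<mu>}|"
  and mu_less: "\<mu> < \<theta>"
  and cof_less: "\<theta> < \<Lambda>"
  and chi_cardinal: "i < \<theta> \<Longrightarrow> is_cardinal (\<chi> i)"
  and chi_strict: "strict_mono_on {..<\<theta>} \<chi>"
  and chi_continuous:
    "\<delta> < \<theta> \<Longrightarrow> ord_limit \<delta> \<Longrightarrow> isLub UNIV (\<chi> ` {..<\<delta>}) (\<chi> \<delta>)"
  and chi_zero: "\<chi> ord_zero = ord_zero"
  and cof_less_chi: "\<theta> < \<chi> (ord_succ ord_zero)"
  and chi_Lub: "isLub UNIV (\<chi> ` {..<\<theta>}) \<Lambda>"
  using good ordIso_imp_ordLeq[OF ordIso_symmetric] unfolding good_parameter_def by blast+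

lemma mu_cardinal: "is_cardinal \<mu>"
  and card_mu_seqs: "|{..<\<mu>}| =o |seqs_shorter \<mu> \<mu>|"
  using good unfolding good_parameter_def by blast+

lemma not_cofinal:
  assumes "\<delta> < \<theta>" "f ` {..<\<delta>} \<subseteq> {..<\<Lambda>}"
  obtains \<beta> where "\<beta> < \<Lambda>" "\<And>\<xi>. \<xi> < \<delta> \<Longrightarrow> f \<xi> < \<beta>"
proof -
  have "\<not> (\<forall>\<beta><\<Lambda>. \<exists>\<xi><\<delta>. \<beta> \<le> f \<xi>)"
    using not_less_Least[OF assms(1)[unfolded cofinality_def]] assms(2) by blast
  with that show thesis by (auto simp: not_le)
qed

lemma cofinal_map:
  obtains f where "f ` {..<\<theta>} \<subseteq> {..<\<Lambda>}" "\<And>\<beta>. \<beta> < \<Lambda> \<Longrightarrow> \<exists>\<xi><\<theta>. \<beta> \<le> f \<xi>"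
proof -
  let ?P = "\<lambda>\<delta>. \<exists>f. f ` {..<\<delta>} \<subseteq> {..<\<Lambda>} \<and> (\<forall>\<beta><\<Lambda>. \<exists>\<xi><\<delta>. \<beta> \<le> f \<xi>)"
  have "?P \<Lambda>"
    by (rule exI[of _ id]) auto
  then have "?P \<theta>"
    unfolding cofinality_def by (rule LeastI)
  with that show thesis by blast
qed

text \<open>
  Were the cofinality a successor, moving its last element to the front would turn a cofinal map
  into one on its predecessor.
\<close>
lemma succ_less_cof:
  assumes "i < \<theta>"
  shows "ord_succ i < \<theta>"
proof (rule ccontr)
  assume "\<not> ord_succ i < \<theta>"
  then have eq: "ord_succ i = \<theta>"
    using ord_succ_le[OF assms] by simp
  have "{..<\<theta>} = insert i {..<i}"
  proof
    show "{..<\<theta>} \<subseteq> insert i {..<i}"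
      using ord_succ_le[of i] eq by (metis insertCI lessThan_iff linorder_neqE not_le subsetI)
  qed (use assms in auto)
  moreover have "infinite {..<\<theta>}"
    using mu_infinite mu_less by (meson finite_subset lessThan_subset_iff less_imp_le)
  ultimately obtain h where h: "bij_betw h {..<i} {..<\<theta>}"
    using infinite_imp_bij_betw2[of "{..<i}" i] by auto
  obtain f where f: "f ` {..<\<theta>} \<subseteq> {..<\<Lambda>}" "\<And>\<beta>. \<beta> < \<Lambda> \<Longrightarrow> \<exists>\<xi><\<theta>. \<beta> \<le> f \<xi>"
    using cofinal_map by metis
  have "(f \<circ> h) ` {..<i} \<subseteq> {..<\<Lambda>}"
    unfolding image_comp[symmetric] bij_betw_imp_surj_on[OF h] by (rule f(1))
  then obtain \<beta> where \<beta>: "\<beta> < \<Lambda>" "\<And>\<xi>. \<xi> < i \<Longrightarrow> (f \<circ> h) \<xi> < \<beta>"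
    using not_cofinal[OF assms] by metis
  obtain \<xi> where \<xi>: "\<xi> < \<theta>" "\<beta> \<le> f \<xi>" using f(2) \<beta>(1) by blast
  then obtain \<xi>' where "\<xi>' < i" "h \<xi>' = \<xi>"
    using h unfolding bij_betw_def by (metis imageE lessThan_iff)
  with \<beta>(2) \<xi>(2) show False by fastforce
qed

lemma chi_less_iff: "i < \<theta> \<Longrightarrow> j < \<theta> \<Longrightarrow> \<chi> i < \<chi> j \<longleftrightarrow> i < j"
  using chi_strict by (simp add: strict_mono_on_less)

lemma chi_le_iff: "i < \<theta> \<Longrightarrow> j < \<theta> \<Longrightarrow> \<chi> i \<le> \<chi> j \<longleftrightarrow> i \<le> j"
  using chi_less_iff by (meson not_le)

lemma chi_less: "i < \<theta> \<Longrightarrow> \<chi> i < \<Lambda>"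
proof -
  assume i: "i < \<theta>"
  have "\<chi> i < \<chi> (ord_succ i)"
    using i succ_less_cof less_ord_succ chi_less_iff by blast
  also have "\<dots> \<le> \<Lambda>"
    using chi_Lub succ_less_cof[OF i] by (auto simp: isLub_def leastP_def isUb_def setle_def)
  finally show ?thesis .
qed

lemma chi_cofinal:
  assumes "\<alpha> < \<Lambda>"
  obtains i where "i < \<theta>" "\<alpha> < \<chi> i"
proof -
  have "\<not> isUb UNIV (\<chi> ` {..<\<theta>}) \<alpha>"
    using chi_Lub assms by (auto simp: isLub_def leastP_def setge_def)
  with that show thesis by (auto simp: isUb_def setle_def not_le)
qed

text \<open>By continuity, the first \<open>\<chi> i\<close> beyond an ordinal has a successor index.\<close>
lemma block_exists:
  assumes "\<alpha> < \<Lambda>"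
  obtains i where "i < \<theta>" "\<chi> i \<le> \<alpha>" "\<alpha> < \<chi> (ord_succ i)"
proof -
  define k where "k = (LEAST k. k < \<theta> \<and> \<alpha> < \<chi> k)"
  have k: "k < \<theta>" "\<alpha> < \<chi> k"
    using LeastI_ex[of "\<lambda>k. k < \<theta> \<and> \<alpha> < \<chi> k"] chi_cofinal[OF assms] unfolding k_def by blast+
  have below: "\<chi> j \<le> \<alpha>" if "j < k" for j
    using not_less_Least[OF that[unfolded k_def]] that k by auto
  have "k \<noteq> ord_zero"
    using k(2) chi_zero ord_zero_le[of \<alpha>] by auto
  moreover have "\<not> ord_limit k"
  proof
    assume "ord_limit k"
    then have "isLub UNIV (\<chi> ` {..<k}) (\<chi> k)" using chi_continuous k(1) by blast
    moreover have "isUb UNIV (\<chi> ` {..<k}) \<alpha>"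
      using below by (auto simp: isUb_def setle_def)
    ultimately have "\<chi> k \<le> \<alpha>" by (auto simp: isLub_def leastP_def setge_def)
    with k(2) show False by simp
  qed
  ultimately obtain i where i: "i < k" "\<And>j. j < k \<Longrightarrow> j \<le> i"
    unfolding ord_limit_def by (meson not_le)
  have "ord_succ i = k"
    using i ord_succ_le[OF i(1)] less_ord_succ[OF i(1)] by (meson leD le_less)
  with that[of i] i(1) k below[OF i(1)] show thesis by simp
qed

lemma block_eq:
  assumes "i < \<theta>" "\<chi> i \<le> \<alpha>" "\<alpha> < \<chi> (ord_succ i)"
  shows "block \<Lambda> \<chi> \<alpha> = i"
  unfolding block_def
proof (rule the_equality)
  fix j assume j: "j < \<theta> \<and> \<chi> j \<le> \<alpha> \<and> \<alpha> < \<chi> (ord_succ j)"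
  have "\<not> j < i" "\<not> i < j"
    using assms j ord_succ_le chi_le_iff succ_less_cof by (meson leD le_less_trans)+
  then show "j = i" by simp
qed (use assms in simp)

lemma block_props:
  assumes "\<alpha> < \<Lambda>"
  shows "block \<Lambda> \<chi> \<alpha> < \<theta>" "\<chi> (block \<Lambda> \<chi> \<alpha>) \<le> \<alpha>" "\<alpha> < \<chi> (ord_succ (block \<Lambda> \<chi> \<alpha>))"
  using block_exists[OF assms] block_eq by metis+

lemma block_mono:
  assumes "\<alpha> < \<Lambda>" "\<beta> < \<Lambda>" "block \<Lambda> \<chi> \<alpha> < block \<Lambda> \<chi> \<beta>"
  shows "\<alpha> < \<beta>"
proof -
  have "\<chi> (ord_succ (block \<Lambda> \<chi> \<alpha>)) \<le> \<chi> (block \<Lambda> \<chi> \<beta>)"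
    using assms block_props ord_succ_le chi_le_iff succ_less_cof by metis
  with block_props assms show ?thesis by (meson le_less_trans less_le_trans)
qed

text \<open>
  A well-order shorter than \<open>\<Lambda>\<close> is isomorphic to a proper initial segment of \<open>\<Lambda>\<close>, which is
  contained in some \<open>\<chi> i\<close>.
\<close>
lemma Lambda_ordLeqI:
  assumes "Well_order r" "\<And>i. i < \<theta> \<Longrightarrow> |{..<\<chi> i}| \<le>o r"
  shows "|{..<\<Lambda>}| \<le>o r"
proof (rule ccontr)
  assume "\<not> |{..<\<Lambda>}| \<le>o r"
  then have "r <o |{..<\<Lambda>}|" using assms(1) by simp
  then obtain \<alpha> where \<alpha>: "\<alpha> < \<Lambda>" "r =o below_order \<alpha>"
    using ordLess_cardinalE[OF Lambda_cardinal] by blast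
  obtain i where i: "i < \<theta>" "\<alpha> < \<chi> i" using chi_cofinal[OF \<alpha>(1)] .
  have "|{..<\<chi> i}| \<le>o below_order \<alpha>"
    by (rule ordLeq_ordIso_trans[OF assms(2)[OF i(1)] \<alpha>(2)])
  from card_of_mono2[OF this] have "|{..<\<chi> i}| \<le>o |{..<\<alpha>}|"
    by (simp add: Field_below_order)
  with chi_cardinal[OF i(1)] i(2) show False
    using cardinal_not_ordLeq by blast
qed

text \<open>
  At most \<open>\<mu>\<close>, and hence fewer than the cofinality, many sets of size less than \<open>\<Lambda>\<close> have sizes bounded below \<open>\<Lambda>\<close>, hence
  a union of size less than \<open>\<Lambda>\<close>.
\<close>
lemma pigeonhole:
  assumes "|{..<\<Lambda>}| \<le>o |\<Union>c\<in>C. F c|" "|C| \<le>o |{..<\<mu>}|"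
  shows "\<exists>c\<in>C. |{..<\<Lambda>}| \<le>o |F c|"
proof (rule ccontr)
  assume none: "\<not> (\<exists>c\<in>C. |{..<\<Lambda>}| \<le>o |F c| )"
  have "\<forall>c\<in>C. \<exists>\<alpha>. \<alpha> < \<Lambda> \<and> |F c| \<le>o |{..<\<alpha>}|"
  proof
    fix c assume "c \<in> C"
    with none have "|F c| <o |{..<\<Lambda>}|"
      using not_ordLeq_iff_ordLess[of "|F c|" "|{..<\<Lambda>}|"] by (simp add: card_of_Well_order)
    then show "\<exists>\<alpha>. \<alpha> < \<Lambda> \<and> |F c| \<le>o |{..<\<alpha>}|"
      by (rule card_of_ordLess_cardinalE[OF Lambda_cardinal]) blast
  qed
  from bchoice[OF this] obtain b
    where b: "\<And>c. c \<in> C \<Longrightarrow> b c < \<Lambda>" "\<And>c. c \<in> C \<Longrightarrow> |F c| \<le>o |{..<b c}|"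
    by blast
  have "C \<noteq> {}"
  proof
    assume "C = {}"
    then show False
      using card_of_ordLeq_infinite[OF assms(1) Lambda_infinite] by simp
  qed
  then obtain e where e: "e ` {..<\<mu>} = C"
    using assms(2) card_of_ordLeq2[of C "{..<\<mu>}"] by blast
  then have "(b \<circ> e) ` {..<\<mu>} \<subseteq> {..<\<Lambda>}" using b by auto
  then obtain \<beta> where \<beta>: "\<beta> < \<Lambda>" "\<And>\<xi>. \<xi> < \<mu> \<Longrightarrow> (b \<circ> e) \<xi> < \<beta>"
    using not_cofinal[OF mu_less, of "b \<circ> e"] by metis
  let ?B = "{..<max \<mu> \<beta>}"
  have "infinite ?B"
    using mu_infinite by (meson finite_subset lessThan_subset_iff max.cobounded1)
  moreover have "|C| \<le>o |?B|"
    by (rule ordLeq_transitive[OF assms(2) card_lessThan_mono]) simp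
  moreover have "\<forall>c\<in>C. |F c| \<le>o |?B|"
  proof
    fix c assume c: "c \<in> C"
    then obtain \<xi> where "\<xi> < \<mu>" "c = e \<xi>" using e by auto
    then have "b c \<le> max \<mu> \<beta>" using less_imp_le[OF \<beta>(2)[of \<xi>]] by (simp add: le_max_iff_disj)
    then show "|F c| \<le>o |?B|"
      by (rule ordLeq_transitive[OF b(2)[OF c] card_lessThan_mono])
  qed
  ultimately have "|\<Union>c\<in>C. F c| \<le>o |?B|" by (rule card_of_UNION_ordLeq_infinite)
  then have "|{..<\<Lambda>}| \<le>o |?B|" by (rule ordLeq_transitive[OF assms(1)])
  moreover have "max \<mu> \<beta> < \<Lambda>" using \<beta>(1) mu_less cof_less by simp
  ultimately show False
    using cardinal_not_ordLeq[OF Lambda_cardinal] by blast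
qed

end


section \<open>Semantics of the presented algebra\<close>

primrec holds :: "('a \<Rightarrow> bool) \<Rightarrow> 'a bterm \<Rightarrow> bool" where
  "holds f (Gen a) = f a"
| "holds f Zero = False"
| "holds f One = True"
| "holds f (Compl s) = (\<not> holds f s)"
| "holds f (Meet s t) = (holds f s \<and> holds f t)"
| "holds f (Join s t) = (holds f s \<or> holds f t)"

lemma holds_foldr_Meet: "holds f (foldr Meet ts One) \<longleftrightarrow> (\<forall>t\<in>set ts. holds f t)"
  by (induction ts) auto

lemma holds_foldr_Join: "holds f (foldr Join ts Zero) \<longleftrightarrow> (\<exists>t\<in>set ts. holds f t)"
  by (induction ts) auto

lemma holds_cong: "(\<And>a. a \<in> set_bterm s \<Longrightarrow> f a = g a) \<Longrightarrow> holds f s = holds g s"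
  by (induction s) auto

lemma finite_set_bterm: "finite (set_bterm s)"
  by (induction s) auto

lemma bequiv_sound:
  assumes "bequiv w F s t" "f \<in> F"
  shows "holds f s = holds f t"
  using assms(1)
proof induction
  case (relation u0 u1)
  then have "\<not> ((\<forall>\<alpha>\<in>set u0. \<not> f \<alpha>) \<and> (\<forall>\<alpha>\<in>set u1. f \<alpha>))"
    using assms(2) by blast
  then show ?case
    by (simp add: holds_foldr_Meet ball_Un conj_commute del: foldr_append map_append)
qed (simp_all, blast+)

abbreviation (input) minterm :: "'a list \<Rightarrow> 'a list \<Rightarrow> 'a bterm"
  where "minterm u0 u1 \<equiv> foldr Meet (map Gen u1 @ map (\<lambda>\<alpha>. Compl (Gen \<alpha>)) u0) One"

context
  fixes w :: "'a set" and F :: "('a \<Rightarrow> bool) set"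
begin

lemma bequiv_meet_left_cong: "bequiv w F s s' \<Longrightarrow> bequiv w F (Meet s t) (Meet s' t)"
  by (rule bequiv.meet_cong[OF _ bequiv.refl])

lemma bequiv_meet_right_cong: "bequiv w F t t' \<Longrightarrow> bequiv w F (Meet s t) (Meet s t')"
  by (rule bequiv.meet_cong[OF bequiv.refl])

lemma bequiv_meet_left_commute: "bequiv w F (Meet s (Meet t u)) (Meet t (Meet s u))"
proof -
  have "bequiv w F (Meet s (Meet t u)) (Meet (Meet s t) u)"
    by (rule bequiv.sym) (rule bequiv.meet_assoc)
  also have "bequiv w F \<dots> (Meet (Meet t s) u)"
    by (rule bequiv_meet_left_cong) (rule bequiv.meet_commute)
  also have "bequiv w F \<dots> (Meet t (Meet s u))"
    by (rule bequiv.meet_assoc)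
  finally show ?thesis .
qed

lemma bequiv_one_meet: "bequiv w F (Meet One s) s"
  by (rule bequiv.trans[OF bequiv.meet_commute bequiv.meet_one])

lemma bequiv_zero_join: "bequiv w F (Join Zero s) s"
  by (rule bequiv.trans[OF bequiv.join_commute bequiv.join_zero])

lemma bequiv_join_idem: "bequiv w F (Join s s) s"
proof -
  have "bequiv w F (Join s s) (Join (Meet s (Join s s)) (Meet s (Join s s)))"
    by (rule bequiv.join_cong) (rule bequiv.sym[OF bequiv_absorb])+
  also have "bequiv w F \<dots> (Meet s (Join (Join s s) (Join s s)))"
    by (rule bequiv.sym) (rule bequiv.meet_join_distrib)
  also have "bequiv w F \<dots> (Meet s (Join s (Join s (Join s s))))"
    by (rule bequiv_meet_right_cong) (rule bequiv.join_assoc)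
  also have "bequiv w F \<dots> s"
    by (rule bequiv_absorb)
  finally show ?thesis .
qed

lemma bequiv_split: "bequiv w F s (Join (Meet s t) (Meet s (Compl t)))"
proof -
  have "bequiv w F s (Meet s One)"
    by (rule bequiv.sym) (rule bequiv.meet_one)
  also have "bequiv w F \<dots> (Meet s (Join t (Compl t)))"
    by (rule bequiv_meet_right_cong) (rule bequiv.sym[OF bequiv.join_compl])
  also have "bequiv w F \<dots> (Join (Meet s t) (Meet s (Compl t)))"
    by (rule bequiv.meet_join_distrib)
  finally show ?thesis .
qed

lemma foldr_Meet_le:
  assumes "t \<in> set ts"
  shows "bequiv w F (Meet (foldr Meet ts One) t) (foldr Meet ts One)"
  using assms
proof (induction ts)
  case (Cons a ts)
  let ?M = "foldr Meet ts One"
  show ?case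
  proof (cases "t = a")
    case True
    have "bequiv w F (Meet (Meet a ?M) a) (Meet a (Meet a ?M))" by (rule bequiv.meet_commute)
    also have "bequiv w F \<dots> (Meet (Meet a a) ?M)" by (rule bequiv.sym) (rule bequiv.meet_assoc)
    also have "bequiv w F \<dots> (Meet a ?M)" by (rule bequiv_meet_left_cong) (rule bequiv_meet_idem)
    finally show ?thesis using True by simp
  next
    case False
    with Cons have IH: "bequiv w F (Meet ?M t) ?M" by simp
    have "bequiv w F (Meet (Meet a ?M) t) (Meet a (Meet ?M t))" by (rule bequiv.meet_assoc)
    also have "bequiv w F \<dots> (Meet a ?M)" by (rule bequiv_meet_right_cong) (rule IH)
    finally show ?thesis by simp
  qed
qed simp

text \<open>
  Below the minterm every generator of \<open>s\<close> is either \<open>One\<close> or \<open>Zero\<close>, and the Boolean operations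
  propagate these values; so the minterm is below \<open>s\<close> or disjoint from it.
\<close>
lemma minterm_decides:
  assumes "set_bterm s \<subseteq> set u0 \<union> set u1"
    and "\<forall>\<alpha>\<in>set u0. \<not> f \<alpha>" "\<forall>\<alpha>\<in>set u1. f \<alpha>"
  shows "bequiv w F (Meet (minterm u0 u1) s) (if holds f s then minterm u0 u1 else Zero)"
  using assms(1)
proof (induction s)
  case (Gen a)
  let ?M = "minterm u0 u1"
  show ?case
  proof (cases "f a")
    case True
    with Gen assms have "Gen a \<in> set (map Gen u1 @ map (\<lambda>\<alpha>. Compl (Gen \<alpha>)) u0)" by auto
    from foldr_Meet_le[OF this] True show ?thesis by simp
  next
    case False
    with Gen assms have "Compl (Gen a) \<in> set (map Gen u1 @ map (\<lambda>\<alpha>. Compl (Gen \<alpha>)) u0)" by auto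
    from foldr_Meet_le[OF this]
    have "bequiv w F (Meet ?M (Gen a)) (Meet (Meet ?M (Compl (Gen a))) (Gen a))"
      by (rule bequiv_meet_left_cong[OF bequiv.sym])
    also have "bequiv w F \<dots> (Meet ?M (Meet (Compl (Gen a)) (Gen a)))" by (rule bequiv.meet_assoc)
    also have "bequiv w F \<dots> (Meet ?M (Meet (Gen a) (Compl (Gen a))))"
      by (rule bequiv_meet_right_cong) (rule bequiv.meet_commute)
    also have "bequiv w F \<dots> (Meet ?M Zero)"
      by (rule bequiv_meet_right_cong) (rule bequiv.meet_compl)
    also have "bequiv w F \<dots> Zero" by (rule bequiv_meet_zero)
    finally show ?thesis using False by simp
  qed
next
  case (Compl s)
  let ?M = "minterm u0 u1"
  show ?case
  proof (cases "holds f s")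
    case True
    with Compl have IH: "bequiv w F (Meet ?M s) ?M" by simp
    have "bequiv w F (Meet ?M (Compl s)) (Meet (Meet ?M s) (Compl s))"
      by (rule bequiv_meet_left_cong[OF bequiv.sym[OF IH]])
    also have "bequiv w F \<dots> (Meet ?M (Meet s (Compl s)))" by (rule bequiv.meet_assoc)
    also have "bequiv w F \<dots> (Meet ?M Zero)"
      by (rule bequiv_meet_right_cong) (rule bequiv.meet_compl)
    also have "bequiv w F \<dots> Zero" by (rule bequiv_meet_zero)
    finally show ?thesis using True by simp
  next
    case False
    with Compl have IH: "bequiv w F (Meet ?M s) Zero" by simp
    have "bequiv w F (Meet ?M (Compl s)) (Join Zero (Meet ?M (Compl s)))"
      by (rule bequiv.sym) (rule bequiv_zero_join)
    also have "bequiv w F \<dots> (Join (Meet ?M s) (Meet ?M (Compl s)))"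
      by (rule bequiv.join_cong[OF bequiv.sym[OF IH] bequiv.refl])
    also have "bequiv w F \<dots> ?M"
      by (rule bequiv.sym) (rule bequiv_split)
    finally show ?thesis using False by simp
  qed
next
  case (Meet s t)
  let ?M = "minterm u0 u1"
  have IH: "bequiv w F (Meet ?M s) (if holds f s then ?M else Zero)"
    "bequiv w F (Meet ?M t) (if holds f t then ?M else Zero)"
    using Meet by auto
  have "bequiv w F (Meet ?M (Meet s t)) (Meet (Meet ?M s) t)"
    by (rule bequiv.sym) (rule bequiv.meet_assoc)
  also have "bequiv w F \<dots> (Meet (if holds f s then ?M else Zero) t)"
    by (rule bequiv_meet_left_cong) (rule IH)
  also have "bequiv w F \<dots> (if holds f s \<and> holds f t then ?M else Zero)"
    using IH(2) bequiv_zero_meet by (cases "holds f s") simp_all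
  finally show ?case by simp
next
  case (Join s t)
  let ?M = "minterm u0 u1"
  have IH: "bequiv w F (Meet ?M s) (if holds f s then ?M else Zero)"
    "bequiv w F (Meet ?M t) (if holds f t then ?M else Zero)"
    using Join by auto
  have "bequiv w F (Meet ?M (Join s t)) (Join (Meet ?M s) (Meet ?M t))"
    by (rule bequiv.meet_join_distrib)
  also have "bequiv w F \<dots> (Join (if holds f s then ?M else Zero) (if holds f t then ?M else Zero))"
    by (rule bequiv.join_cong) (rule IH)+
  also have "bequiv w F \<dots> (if holds f s \<or> holds f t then ?M else Zero)"
    using bequiv_join_idem bequiv.join_zero bequiv_zero_join
    by (cases "holds f s"; cases "holds f t") simp_all
  finally show ?case by simp
qed (simp_all add: bequiv_meet_zero bequiv.meet_one)

lemma minterm_Cons_negative: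
  "bequiv w F (Meet (Compl (Gen a)) (minterm u0 u1)) (minterm (a # u0) u1)"
proof (induction u1)
  case (Cons b u1)
  have "bequiv w F (Meet (Compl (Gen a)) (Meet (Gen b) (minterm u0 u1)))
      (Meet (Gen b) (Meet (Compl (Gen a)) (minterm u0 u1)))"
    by (rule bequiv_meet_left_commute)
  also have "bequiv w F \<dots> (Meet (Gen b) (minterm (a # u0) u1))"
    by (rule bequiv_meet_right_cong) (rule Cons)
  finally show ?case by simp
qed (simp add: bequiv.refl)

text \<open>
  By induction on the number of generators not yet decided: once all are decided, either some
  element of \<open>F\<close> is compatible with the minterm and falsifies \<open>s\<close>, or the minterm is one
  of the defining relations.
\<close>
lemma minterm_meet_zero:
  assumes "set_bterm s \<subseteq> w" "set u0 \<subseteq> w" "set u1 \<subseteq> w"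
    and "\<And>f. f \<in> F \<Longrightarrow> \<forall>\<alpha>\<in>set u0. \<not> f \<alpha> \<Longrightarrow> \<forall>\<alpha>\<in>set u1. f \<alpha> \<Longrightarrow> \<not> holds f s"
  shows "bequiv w F (Meet (minterm u0 u1) s) Zero"
  using assms(2-)
proof (induction "card (set_bterm s - (set u0 \<union> set u1))" arbitrary: u0 u1)
  case 0
  have decided: "set_bterm s \<subseteq> set u0 \<union> set u1"
  proof -
    have "set_bterm s - (set u0 \<union> set u1) = {}"
      using 0(1) card_0_eq[OF finite_Diff[OF finite_set_bterm]] by metis
    then show ?thesis by blast
  qed
  show ?case
  proof (cases "\<exists>f\<in>F. (\<forall>\<alpha>\<in>set u0. \<not> f \<alpha>) \<and> (\<forall>\<alpha>\<in>set u1. f \<alpha>)")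
    case True
    then obtain f where f: "f \<in> F" "\<forall>\<alpha>\<in>set u0. \<not> f \<alpha>" "\<forall>\<alpha>\<in>set u1. f \<alpha>" by blast
    then have "\<not> holds f s" by (rule 0(4))
    with minterm_decides[OF decided f(2,3)] show ?thesis by simp
  next
    case False
    then have "bequiv w F (minterm u0 u1) Zero"
      by (rule bequiv.relation[OF 0(2,3)])
    from bequiv_meet_left_cong[OF this] bequiv_zero_meet show ?thesis
      by (rule bequiv.trans)
  qed
next
  case (Suc n)
  have "set_bterm s - (set u0 \<union> set u1) \<noteq> {}"
  proof
    assume "set_bterm s - (set u0 \<union> set u1) = {}"
    with Suc(2) show False by simp
  qed
  then obtain a where a: "a \<in> set_bterm s - (set u0 \<union> set u1)" by blast
  let ?M = "minterm u0 u1"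
  have n: "n = card (set_bterm s - (set u0 \<union> set (a # u1)))"
    "n = card (set_bterm s - (set (a # u0) \<union> set u1))"
  proof -
    have "n = card (set_bterm s - (set u0 \<union> set u1) - {a})"
      using Suc(2) card_Suc_Diff1[OF finite_Diff[OF finite_set_bterm] a] by simp
    moreover have "set_bterm s - (set u0 \<union> set u1) - {a} = set_bterm s - (set u0 \<union> set (a # u1))"
      "set_bterm s - (set u0 \<union> set u1) - {a} = set_bterm s - (set (a # u0) \<union> set u1)"
      by auto
    ultimately show "n = card (set_bterm s - (set u0 \<union> set (a # u1)))"
      "n = card (set_bterm s - (set (a # u0) \<union> set u1))" by (simp_all only:)
  qed
  have aw: "a \<in> w" using a assms(1) by blast
  have "bequiv w F (Meet (minterm u0 (a # u1)) s) Zero"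
    by (rule Suc(1)[OF n(1)]) (use aw Suc(3,4) in simp_all, rule Suc(5), simp_all)
  then have pos: "bequiv w F (Meet (Meet (Gen a) ?M) s) Zero" by simp
  have "bequiv w F (Meet (minterm (a # u0) u1) s) Zero"
    by (rule Suc(1)[OF n(2)]) (use aw Suc(3,4) in simp_all, rule Suc(5), simp_all)
  then have neg: "bequiv w F (Meet (Meet (Compl (Gen a)) ?M) s) Zero"
    by (rule bequiv.trans[OF bequiv_meet_left_cong[OF minterm_Cons_negative]])
  have swap: "bequiv w F (Meet (Meet ?M s) t) (Meet (Meet t ?M) s)" for t
    by (rule bequiv.trans[OF bequiv.meet_commute bequiv.sym[OF bequiv.meet_assoc]])
  have "bequiv w F (Meet ?M s) (Join (Meet (Meet ?M s) (Gen a)) (Meet (Meet ?M s) (Compl (Gen a))))"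
    by (rule bequiv_split)
  also have "bequiv w F \<dots> (Join Zero Zero)"
    by (rule bequiv.join_cong[OF bequiv.trans[OF swap pos] bequiv.trans[OF swap neg]])
  also have "bequiv w F \<dots> Zero"
    by (rule bequiv.join_zero)
  finally show ?case .
qed

text \<open>
  Soundness is an induction over the congruence.  For completeness, no element of \<open>F\<close> satisfies
  \<open>s \<and> -t\<close>, so that this term is equivalent to \<open>Zero\<close>.
\<close>
lemma bequiv_le_iff_holds:
  assumes "s \<in> bterms w" "t \<in> bterms w"
  shows "bequiv w F (Meet s t) s \<longleftrightarrow> (\<forall>f\<in>F. holds f s \<longrightarrow> holds f t)"
proof
  assume "bequiv w F (Meet s t) s"
  from bequiv_sound[OF this] show "\<forall>f\<in>F. holds f s \<longrightarrow> holds f t" by auto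
next
  assume *: "\<forall>f\<in>F. holds f s \<longrightarrow> holds f t"
  let ?d = "Meet s (Compl t)"
  have "bequiv w F (Meet (minterm [] []) ?d) Zero"
    by (rule minterm_meet_zero) (use assms * in \<open>auto simp: bterms_def\<close>)
  then have "bequiv w F (Meet One ?d) Zero" by simp
  then have zero: "bequiv w F ?d Zero"
    by (rule bequiv.trans[OF bequiv.sym[OF bequiv_one_meet]])
  have "bequiv w F (Meet s t) (Join (Meet s t) Zero)"
    by (rule bequiv.sym) (rule bequiv.join_zero)
  also have "bequiv w F \<dots> (Join (Meet s t) ?d)"
    by (rule bequiv.join_cong[OF bequiv.refl bequiv.sym[OF zero]])
  also have "bequiv w F \<dots> s"
    by (rule bequiv.sym) (rule bequiv_split)
  finally show "bequiv w F (Meet s t) s" .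
qed

end

lemma presented_ba_le_join_iff:
  assumes "s \<in> bterms w" "finite T" "T \<subseteq> bterms w"
  shows "bequiv_rel w F `` {s} \<sqsubseteq>\<^bsub>presented_ba w F\<^esub>
      \<Squnion>\<^bsub>presented_ba w F\<^esub> ((\<lambda>t. bequiv_rel w F `` {t}) ` T) \<longleftrightarrow>
    (\<forall>f\<in>F. holds f s \<longrightarrow> (\<exists>t\<in>T. holds f t))"
proof -
  obtain ts where ts: "set ts = T" using finite_list[OF assms(2)] by blast
  have "foldr Join ts Zero \<in> bterms w"
    using assms(3) unfolding ts[symmetric] by (induction ts) (auto simp: bterms_def)
  then show ?thesis
    using presented_ba_finite_join[of ts w F] assms
    by (simp add: ts presented_ba_le bequiv_le_iff_holds holds_foldr_Join)
qed


section \<open>Separated sequences\<close>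

text \<open>
  The three notions of independence differ only in the set \<open>W \<xi>\<close> of indices whose finite joins must
  not lie above \<open>a \<xi>\<close>.
\<close>
definition separated :: "('b, 'm) gorder_scheme \<Rightarrow> 'k rel \<Rightarrow> ('k \<Rightarrow> 'k set) \<Rightarrow> ('k \<Rightarrow> 'b) \<Rightarrow> bool"
  where "separated L \<kappa> W a \<longleftrightarrow> a ` Field \<kappa> \<subseteq> carrier L \<and>
    (\<forall>\<xi>\<in>Field \<kappa>. \<forall>w. finite w \<and> w \<subseteq> W \<xi> \<longrightarrow> \<not> a \<xi> \<sqsubseteq>\<^bsub>L\<^esub> \<Squnion>\<^bsub>L\<^esub>(a ` w))"

lemma ideal_independent_iff: "ideal_independent L \<kappa> a \<longleftrightarrow> separated L \<kappa> (\<lambda>\<xi>. Field \<kappa> - {\<xi>}) a"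
  unfolding ideal_independent_def separated_def ..

lemma left_separated_iff: "left_separated L \<kappa> a \<longleftrightarrow> separated L \<kappa> (aboveS \<kappa>) a"
  unfolding left_separated_def separated_def ..

lemma right_separated_iff: "right_separated L \<kappa> a \<longleftrightarrow> separated L \<kappa> (underS \<kappa>) a"
  unfolding right_separated_def separated_def ..

lemma separated_carrier: "separated L \<kappa> W a \<Longrightarrow> a ` Field \<kappa> \<subseteq> carrier L"
  unfolding separated_def by (rule conjunct1)

lemma separatedD:
  "separated L \<kappa> W a \<Longrightarrow> \<xi> \<in> Field \<kappa> \<Longrightarrow> finite w \<Longrightarrow> w \<subseteq> W \<xi> \<Longrightarrow> \<not> a \<xi> \<sqsubseteq>\<^bsub>L\<^esub> \<Squnion>\<^bsub>L\<^esub>(a ` w)"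
  unfolding separated_def by simp

lemma separated_mono:
  assumes "separated L \<kappa> W a" "\<And>\<xi>. W' \<xi> \<subseteq> W \<xi>"
  shows "separated L \<kappa> W' a"
  unfolding separated_def
proof (intro conjI ballI allI impI)
  fix \<xi> w assume "\<xi> \<in> Field \<kappa>" and w: "finite w \<and> w \<subseteq> W' \<xi>"
  moreover have "w \<subseteq> W \<xi>" by (rule order.trans[OF conjunct2[OF w] assms(2)])
  ultimately show "\<not> a \<xi> \<sqsubseteq>\<^bsub>L\<^esub> \<Squnion>\<^bsub>L\<^esub>(a ` w)"
    using separatedD[OF assms(1)] by blast
qed (rule separated_carrier[OF assms(1)])

lemma aboveS_subset: "aboveS \<kappa> \<xi> \<subseteq> Field \<kappa> - {\<xi>}"
  by (auto simp: aboveS_def Field_def)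

lemma underS_subset: "underS \<kappa> \<xi> \<subseteq> Field \<kappa> - {\<xi>}"
  by (auto simp: underS_def Field_def)

lemma ideal_independent_imp_left_separated: "ideal_independent L \<kappa> a \<Longrightarrow> left_separated L \<kappa> a"
  unfolding ideal_independent_iff left_separated_iff by (rule separated_mono[OF _ aboveS_subset])

lemma ideal_independent_imp_right_separated: "ideal_independent L \<kappa> a \<Longrightarrow> right_separated L \<kappa> a"
  unfolding ideal_independent_iff right_separated_iff by (rule separated_mono[OF _ underS_subset])

lemma separated_terms:
  assumes sep: "separated (presented_ba w F) \<kappa> W a" and W: "\<And>\<xi>. W \<xi> \<subseteq> Field \<kappa>"
  shows "\<exists>t. (\<forall>\<xi>\<in>Field \<kappa>. t \<xi> \<in> bterms w) \<and>
    (\<forall>\<xi>\<in>Field \<kappa>. \<forall>v. finite v \<and> v \<subseteq> W \<xi> \<longrightarrow>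
      (\<exists>f\<in>F. holds f (t \<xi>) \<and> (\<forall>\<zeta>\<in>v. \<not> holds f (t \<zeta>))))"
proof -
  have "\<forall>\<xi>\<in>Field \<kappa>. \<exists>t\<in>bterms w. a \<xi> = bequiv_rel w F `` {t}"
    using separated_carrier[OF sep] presented_ba_carrier by blast
  then obtain t where t: "\<And>\<xi>. \<xi> \<in> Field \<kappa> \<Longrightarrow> t \<xi> \<in> bterms w"
    "\<And>\<xi>. \<xi> \<in> Field \<kappa> \<Longrightarrow> a \<xi> = bequiv_rel w F `` {t \<xi>}"
    by metis
  show ?thesis
  proof (intro exI[of _ t] conjI ballI allI impI)
    fix \<xi> v assume \<xi>: "\<xi> \<in> Field \<kappa>" and v: "finite v \<and> v \<subseteq> W \<xi>"
    have vF: "v \<subseteq> Field \<kappa>" by (rule order.trans[OF conjunct2[OF v] W])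
    have av: "a ` v = (\<lambda>t. bequiv_rel w F `` {t}) ` (t ` v)"
      unfolding image_image using t(2) vF by (intro image_cong) auto
    have tv: "t ` v \<subseteq> bterms w" using t(1) vF by auto
    from separatedD[OF sep \<xi> conjunct1[OF v] conjunct2[OF v]]
    have "\<not> (\<forall>f\<in>F. holds f (t \<xi>) \<longrightarrow> (\<exists>s\<in>t ` v. holds f s))"
      unfolding av t(2)[OF \<xi>]
        presented_ba_le_join_iff[OF t(1)[OF \<xi>] finite_imageI[OF conjunct1[OF v]] tv] .
    then show "\<exists>f\<in>F. holds f (t \<xi>) \<and> (\<forall>\<zeta>\<in>v. \<not> holds f (t \<zeta>))" by blast
  qed (rule t(1))
qed

lemma separated_inj_on:
  assumes sep: "separated (presented_ba w F) \<kappa> W a"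
    and total: "\<And>\<xi> \<zeta>. \<xi> \<in> Field \<kappa> \<Longrightarrow> \<zeta> \<in> Field \<kappa> \<Longrightarrow> \<xi> \<noteq> \<zeta> \<Longrightarrow> \<zeta> \<in> W \<xi> \<or> \<xi> \<in> W \<zeta>"
  shows "inj_on a (Field \<kappa>)"
proof -
  have "a \<xi> \<noteq> a \<zeta>" if \<xi>: "\<xi> \<in> Field \<kappa>" and \<zeta>: "\<zeta> \<in> W \<xi>" for \<xi> \<zeta>
  proof
    assume eq: "a \<xi> = a \<zeta>"
    obtain t where t: "t \<in> bterms w" "a \<xi> = bequiv_rel w F `` {t}"
      using separated_carrier[OF sep] \<xi> presented_ba_carrier by blast
    have "a \<xi> \<sqsubseteq>\<^bsub>presented_ba w F\<^esub> \<Squnion>\<^bsub>presented_ba w F\<^esub> (a ` {\<zeta>})"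
      using presented_ba_le_join_iff[OF t(1), of "{t}" F] t by (simp add: eq[symmetric])
    with separatedD[OF sep \<xi>, of "{\<zeta>}"] \<zeta> show False by simp
  qed
  with total show ?thesis by (intro inj_onI) metis
qed


section \<open>Thinning out injections of the singular cardinal\<close>

context parameter
begin

text \<open>The cofinality is regular; \<open>\<chi>\<close> transports this from \<open>\<Lambda>\<close>.\<close>
lemma bounded_in_cof:
  assumes "b < \<theta>" "e ` {..<b} \<subseteq> {..<\<theta>}"
  obtains k where "k < \<theta>" "\<And>i. i < b \<Longrightarrow> e i < k"
proof -
  have "(\<chi> \<circ> e) ` {..<b} \<subseteq> {..<\<Lambda>}"
    using assms(2) chi_less by auto
  then obtain \<beta> where \<beta>: "\<beta> < \<Lambda>" "\<And>i. i < b \<Longrightarrow> (\<chi> \<circ> e) i < \<beta>"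
    using not_cofinal[OF assms(1), of "\<chi> \<circ> e"] by metis
  obtain k where k: "k < \<theta>" "\<beta> < \<chi> k" using chi_cofinal[OF \<beta>(1)] .
  have "e i < k" if "i < b" for i
  proof -
    have "\<chi> (e i) < \<chi> k" using \<beta>(2)[OF that] k(2) by simp
    moreover have "e i < \<theta>" using assms(2) that by auto
    ultimately show ?thesis using chi_less_iff k(1) by blast
  qed
  with k(1) that show thesis by blast
qed

text \<open>
  The set is built greedily: \<open>j\<close> enters as soon as it exceeds \<open>e i\<close> for all earlier members \<open>i\<close>.  If
  it were bounded, the values of \<open>e\<close> on it would be bounded by regularity, and a further \<open>j\<close> would
  enter.
\<close>
lemma sparse_unbounded_set:
  assumes e: "\<And>i. i < \<theta> \<Longrightarrow> e i < \<theta>"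
  obtains I where "I \<subseteq> {..<\<theta>}" "\<And>i j. i \<in> I \<Longrightarrow> j \<in> I \<Longrightarrow> i < j \<Longrightarrow> e i < j"
    and "\<And>b. b < \<theta> \<Longrightarrow> \<exists>i\<in>I. b \<le> i"
proof -
  define J where "J = wfrec {(x :: 'a, y). x < y} (\<lambda>J j. \<forall>i<j. J i \<longrightarrow> e i < j)"
  have J: "J j \<longleftrightarrow> (\<forall>i<j. J i \<longrightarrow> e i < j)" for j
    using def_wfrec[OF eq_reflection[OF J_def] wf_less_wellorder, of j] by (simp add: cut_apply)
  show thesis
  proof (rule that[of "{j. J j \<and> j < \<theta>}"])
    show "e i < j" if "i \<in> {j. J j \<and> j < \<theta>}" "j \<in> {j. J j \<and> j < \<theta>}" "i < j" for i j
      using that J[of j] by blast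
    show "\<exists>i\<in>{j. J j \<and> j < \<theta>}. b \<le> i" if b: "b < \<theta>" for b
    proof (rule ccontr)
      assume "\<not> ?thesis"
      then have bd: "i < b" if "J i" "i < \<theta>" for i using that by (simp add: not_le)
      obtain k where k: "k < \<theta>" "\<And>i. i < b \<Longrightarrow> e i < k"
        using bounded_in_cof[OF b, of e] e b by (auto simp: image_subset_iff)
      have "e i < max b k" if "i < max b k" "J i" for i
      proof -
        have "i < \<theta>" using less_trans[OF that(1), of \<theta>] b k(1) by simp
        from k(2)[OF bd[OF that(2) this]] show ?thesis by (simp add: less_max_iff_disj)
      qed
      then have "J (max b k)" using J by blast
      then show False using bd[of "max b k"] b k(1) by simp
    qed
  qed auto
qed

text \<open>
  Sort the elements of \<open>X\<close> by their own block and the block of their value.  There are so few pairs of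
  blocks that for every \<open>i\<close> one of the resulting pieces is larger than \<open>\<chi> i\<close>, and such a piece has
  both blocks at \<open>i\<close> or later.  Along a sparse set of \<open>i\<close> the two blocks then increase together,
  which makes \<open>g\<close> increasing between different pieces.  Within a piece all values lie in one block.
\<close>
lemma increasing_across_blocks:
  assumes X: "X \<subseteq> {..<\<Lambda>}" "|{..<\<Lambda>}| \<le>o |X|"
    and g: "g ` X \<subseteq> {..<\<Lambda>}" "inj_on g X"
  obtains Z where "Z \<subseteq> X" "|{..<\<Lambda>}| \<le>o |Z|"
    and "\<And>\<xi> \<zeta>. \<xi> \<in> Z \<Longrightarrow> \<zeta> \<in> Z \<Longrightarrow> block \<Lambda> \<chi> (g \<xi>) \<noteq> block \<Lambda> \<chi> (g \<zeta>) \<Longrightarrow>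
      \<xi> < \<zeta> \<longleftrightarrow> g \<xi> < g \<zeta>"
proof -
  define P where
    "P p = {\<xi> \<in> X. block \<Lambda> \<chi> \<xi> = fst p \<and> block \<Lambda> \<chi> (g \<xi>) = snd p}" for p
  let ?T = "{..<\<theta>} \<times> {..<\<theta>}"
  have XL: "\<xi> < \<Lambda>" "g \<xi> < \<Lambda>" if "\<xi> \<in> X" for \<xi>
    using that X(1) g(1) by auto
  have X_eq: "X = (\<Union>p\<in>?T. P p)"
    using XL by (auto simp: P_def block_props(1))
  have "\<forall>i\<in>{..<\<theta>}. \<exists>p. p \<in> ?T \<and> |{..<\<chi> i}| <o |P p|"
  proof (rule ballI, rule ccontr)
    fix i assume i: "i \<in> {..<\<theta>}" and none: "\<not> (\<exists>p. p \<in> ?T \<and> |{..<\<chi> i}| <o |P p| )"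
    let ?B = "{..<max \<theta> (\<chi> i)}"
    have th: "infinite {..<\<theta>}"
      using mu_infinite mu_less by (meson finite_subset lessThan_subset_iff less_imp_le)
    have inf: "infinite ?B"
      using th by (meson finite_subset lessThan_subset_iff max.cobounded1)
    have "|?T| \<le>o |{..<\<theta>}|"
      by (rule ordIso_imp_ordLeq[OF card_of_Times_same_infinite[OF th]])
    then have T: "|?T| \<le>o |?B|"
      by (rule ordLeq_transitive[OF _ card_lessThan_mono]) simp
    have "|P p| \<le>o |?B|" if "p \<in> ?T" for p
    proof -
      have "\<not> |{..<\<chi> i}| <o |P p|" using none that by blast
      then have "|P p| \<le>o |{..<\<chi> i}|"
        using not_ordLess_iff_ordLeq[of "|{..<\<chi> i}|" "|P p|"] by (simp add: card_of_Well_order)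
      then show ?thesis
        by (rule ordLeq_transitive[OF _ card_lessThan_mono]) simp
    qed
    then have "|X| \<le>o |?B|"
      unfolding X_eq by (intro card_of_UNION_ordLeq_infinite[OF inf T]) blast
    then have "|{..<\<Lambda>}| \<le>o |?B|"
      by (rule ordLeq_transitive[OF X(2)])
    moreover have "max \<theta> (\<chi> i) < \<Lambda>" using cof_less chi_less i by simp
    ultimately show False
      using cardinal_not_ordLeq[OF Lambda_cardinal] by blast
  qed
  from bchoice[OF this] obtain p where
    p: "\<And>i. i < \<theta> \<Longrightarrow> p i \<in> ?T" "\<And>i. i < \<theta> \<Longrightarrow> |{..<\<chi> i}| <o |P (p i)|"
    by auto
  \<comment> \<open>A subset of an earlier block has size at most \<open>\<chi> i\<close>; this is used for \<open>h = id\<close> and \<open>h = g\<close>.\<close>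
  have late: "i \<le> k" if i: "i < \<theta>" and k: "k < \<theta>" and h: "inj_on h (P (p i))"
    "\<And>\<xi>. \<xi> \<in> P (p i) \<Longrightarrow> h \<xi> < \<Lambda> \<and> block \<Lambda> \<chi> (h \<xi>) = k" for i k h
  proof (rule ccontr)
    assume "\<not> i \<le> k"
    then have "ord_succ k \<le> i" by (intro ord_succ_le) simp
    then have "\<chi> (ord_succ k) \<le> \<chi> i" using chi_le_iff succ_less_cof i k by blast
    then have "h \<xi> < \<chi> i" if "\<xi> \<in> P (p i)" for \<xi>
      using h(2)[OF that] block_props(3)[of "h \<xi>"] by auto
    then have "h ` P (p i) \<subseteq> {..<\<chi> i}" by auto
    with h(1) have "|P (p i)| \<le>o |{..<\<chi> i}|" using card_of_ordLeq by blast
    with p(2)[OF i] show False using not_ordLess_ordLeq by blast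
  qed
  define e where "e i = max (fst (p i)) (snd (p i))" for i
  have e: "e i < \<theta>" if "i < \<theta>" for i using p(1)[OF that] by (auto simp: e_def)
  obtain I where I: "I \<subseteq> {..<\<theta>}" "\<And>i j. i \<in> I \<Longrightarrow> j \<in> I \<Longrightarrow> i < j \<Longrightarrow> e i < j"
    "\<And>b. b < \<theta> \<Longrightarrow> \<exists>i\<in>I. b \<le> i"
    using sparse_unbounded_set[of e] e by metis
  define Z where "Z = (\<Union>i\<in>I. P (p i))"
  have PX: "P q \<subseteq> X" for q by (auto simp: P_def)
  have size: "|{..<\<Lambda>}| \<le>o |Z|"
  proof (rule Lambda_ordLeqI)
    fix i assume "i < \<theta>"
    then obtain j where j: "j \<in> I" "i \<le> j" using I(3) by blast
    then have jt: "j < \<theta>" using I(1) by auto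
    have "|{..<\<chi> i}| \<le>o |{..<\<chi> j}|"
      using chi_le_iff j(2) jt \<open>i < \<theta>\<close> by (intro card_lessThan_mono) blast
    also have "|{..<\<chi> j}| \<le>o |P (p j)|" using p(2)[OF jt] by (rule ordLess_imp_ordLeq)
    also have "|P (p j)| \<le>o |Z|" using j(1) by (intro card_of_mono1) (auto simp: Z_def)
    finally show "|{..<\<chi> i}| \<le>o |Z|" .
  qed (rule card_of_Well_order)
  have ZX: "Z \<subseteq> X" unfolding Z_def using PX by (rule UN_least)
  have ordered: "\<xi> < \<zeta> \<and> g \<xi> < g \<zeta>"
    if "i \<in> I" "j \<in> I" "i < j" "\<xi> \<in> P (p i)" "\<zeta> \<in> P (p j)" for i j \<xi> \<zeta>
  proof -
    have ij: "i < \<theta>" "j < \<theta>" using that I(1) by auto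
    have lt: "\<xi> < \<Lambda>" "\<zeta> < \<Lambda>" "g \<xi> < \<Lambda>" "g \<zeta> < \<Lambda>" using that(4,5) PX XL by blast+
    have "j \<le> fst (p j)"
      by (rule late[of j _ id]) (use ij(2) p(1)[OF ij(2)] PX XL in \<open>auto simp: P_def\<close>)
    moreover have "j \<le> snd (p j)"
    proof (rule late[of j _ g])
      show "inj_on g (P (p j))" by (rule inj_on_subset[OF g(2) PX])
    qed (use ij(2) p(1)[OF ij(2)] PX XL in \<open>auto simp: P_def\<close>)
    moreover have "fst (p i) < j" "snd (p i) < j"
      using I(2)[OF that(1-3)] by (simp_all add: e_def)
    ultimately have "fst (p i) < fst (p j)" "snd (p i) < snd (p j)" by simp_all
    with that(4,5) show ?thesis
      using block_mono[OF lt(1,2)] block_mono[OF lt(3,4)] by (simp add: P_def)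
  qed
  have "\<xi> < \<zeta> \<longleftrightarrow> g \<xi> < g \<zeta>"
    if "\<xi> \<in> Z" "\<zeta> \<in> Z" "block \<Lambda> \<chi> (g \<xi>) \<noteq> block \<Lambda> \<chi> (g \<zeta>)" for \<xi> \<zeta>
  proof -
    from that(1,2) obtain i j where ij: "i \<in> I" "j \<in> I" "\<xi> \<in> P (p i)" "\<zeta> \<in> P (p j)"
      by (auto simp: Z_def)
    have "i \<noteq> j" using ij(3,4) that(3) by (auto simp: P_def)
    then consider "i < j" | "j < i" by force
    then show ?thesis
    proof cases
      case 1
      from ordered[OF ij(1,2) 1 ij(3,4)] show ?thesis by simp
    next
      case 2
      from ordered[OF ij(2,1) 2 ij(4,3)] show ?thesis by (meson order.asym)
    qed
  qed
  with ZX size show thesis by (rule that)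
qed

end


section \<open>The order on the generators\<close>

text \<open>
  This is \<open>common_init f g \<in> A\<close> together with \<open>lex_less f g\<close> (\<open>splits_in_iff\<close>), with the splitting
  point \<open>\<delta>\<close> made explicit, since the arguments below compare splitting points.
\<close>
definition splits_in :: "('a::wellorder \<rightharpoonup> 'a) set \<Rightarrow> ('a \<rightharpoonup> 'a) \<Rightarrow> ('a \<rightharpoonup> 'a) \<Rightarrow> bool"
  where "splits_in A f g \<longleftrightarrow>
    (\<exists>\<delta>. (\<forall>\<zeta><\<delta>. f \<zeta> = g \<zeta>) \<and> f \<delta> < g \<delta> \<and> f |` {..<\<delta>} \<in> A)"

lemma common_init_eq:
  assumes "\<forall>\<zeta><\<delta>. f \<zeta> = g \<zeta>" "f \<delta> \<noteq> g \<delta>"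
  shows "common_init f g = f |` {..<\<delta>}"
proof -
  have "{\<xi>. \<forall>\<zeta>\<le>\<xi>. f \<zeta> = g \<zeta>} = {..<\<delta>}"
  proof (intro Set.set_eqI iffI)
    fix \<xi> assume "\<xi> \<in> {\<xi>. \<forall>\<zeta>\<le>\<xi>. f \<zeta> = g \<zeta>}"
    with assms(2) have "\<not> \<delta> \<le> \<xi>" by auto
    then show "\<xi> \<in> {..<\<delta>}" by simp
  qed (use assms(1) in auto)
  then show ?thesis by (simp add: common_init_def)
qed

lemma splits_in_iff: "splits_in A f g \<longleftrightarrow> common_init f g \<in> A \<and> lex_less f g"
proof
  assume "splits_in A f g"
  then obtain \<delta> where \<delta>: "\<forall>\<zeta><\<delta>. f \<zeta> = g \<zeta>" "f \<delta> < g \<delta>" "f |` {..<\<delta>} \<in> A"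
    unfolding splits_in_def by blast
  then have "common_init f g = f |` {..<\<delta>}" by (intro common_init_eq) auto
  with \<delta> show "common_init f g \<in> A \<and> lex_less f g" by (auto simp: less_fun_def)
next
  assume *: "common_init f g \<in> A \<and> lex_less f g"
  then obtain \<delta> where \<delta>: "\<forall>\<zeta><\<delta>. f \<zeta> = g \<zeta>" "f \<delta> < g \<delta>"
    unfolding less_fun_def by blast
  then have "common_init f g = f |` {..<\<delta>}" by (intro common_init_eq) auto
  with * \<delta> show "splits_in A f g" unfolding splits_in_def by auto
qed

lemma first_difference:
  fixes f g :: "'a::wellorder \<Rightarrow> 'b"
  assumes "f \<noteq> g"
  obtains \<delta> where "\<forall>\<zeta><\<delta>. f \<zeta> = g \<zeta>" "f \<delta> \<noteq> g \<delta>"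
proof -
  obtain x where "f x \<noteq> g x" using assms by blast
  then have "f (LEAST x. f x \<noteq> g x) \<noteq> g (LEAST x. f x \<noteq> g x)" by (rule LeastI)
  moreover have "\<forall>\<zeta><(LEAST x. f x \<noteq> g x). f \<zeta> = g \<zeta>" using not_less_Least by blast
  ultimately show thesis using that by blast
qed

lemma common_init_cases:
  assumes "f \<noteq> g" "common_init f g \<in> A"
  shows "splits_in A f g \<or> splits_in A g f"
proof -
  obtain \<delta> where \<delta>: "\<forall>\<zeta><\<delta>. f \<zeta> = g \<zeta>" "f \<delta> \<noteq> g \<delta>" using first_difference[OF assms(1)] .
  have "f |` {..<\<delta>} = g |` {..<\<delta>}" using \<delta>(1) by (auto simp: restrict_map_def)
  moreover have "f |` {..<\<delta>} \<in> A" using assms(2) common_init_eq[OF \<delta>] by simp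
  ultimately show ?thesis
    unfolding splits_in_def using \<delta> by (metis linorder_neqE)
qed

lemma splits_in_not_lex: "splits_in A f g \<Longrightarrow> lex_less f g \<and> \<not> lex_less g f"
  using less_fun_asym unfolding splits_in_iff by blast

lemma splits_in_sym_common_init: "splits_in A f g \<Longrightarrow> common_init g f \<in> A"
proof -
  assume "splits_in A f g"
  then obtain \<delta> where \<delta>: "\<forall>\<zeta><\<delta>. f \<zeta> = g \<zeta>" "f \<delta> < g \<delta>" "f |` {..<\<delta>} \<in> A"
    unfolding splits_in_def by blast
  have "common_init g f = g |` {..<\<delta>}" using \<delta> by (intro common_init_eq) auto
  also have "\<dots> = f |` {..<\<delta>}" using \<delta>(1) by (auto simp: restrict_map_def)
  finally show ?thesis using \<delta>(3) by simp
qed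

text \<open>
  The branches \<open>f\<close> and \<open>h\<close> part at the lower one of the two given splitting points, where one
  of the two inequalities (or both, if the points coincide) puts \<open>f\<close> to the left of \<open>h\<close>.
\<close>
lemma splits_in_trans:
  assumes "splits_in A f g" "splits_in A g h"
  shows "splits_in A f h"
proof -
  obtain \<delta> where \<delta>: "\<forall>\<zeta><\<delta>. f \<zeta> = g \<zeta>" "f \<delta> < g \<delta>" "f |` {..<\<delta>} \<in> A"
    using assms(1) unfolding splits_in_def by blast
  obtain \<epsilon> where \<epsilon>: "\<forall>\<zeta><\<epsilon>. g \<zeta> = h \<zeta>" "g \<epsilon> < h \<epsilon>" "g |` {..<\<epsilon>} \<in> A"
    using assms(2) unfolding splits_in_def by blast
  consider "\<delta> < \<epsilon>" | "\<epsilon> < \<delta>" | "\<delta> = \<epsilon>" by force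
  then show ?thesis
  proof cases
    case 1
    then have "\<forall>\<zeta><\<delta>. f \<zeta> = h \<zeta>" "f \<delta> < h \<delta>" using \<delta> \<epsilon> by auto
    with \<delta>(3) show ?thesis unfolding splits_in_def by blast
  next
    case 2
    then have "\<forall>\<zeta><\<epsilon>. f \<zeta> = h \<zeta>" "f \<epsilon> < h \<epsilon>" using \<delta> \<epsilon> by auto
    moreover have "f |` {..<\<epsilon>} = g |` {..<\<epsilon>}" using \<delta>(1) 2 by (auto simp: restrict_map_def)
    ultimately show ?thesis using \<epsilon>(3) unfolding splits_in_def by metis
  next
    case 3
    then have "\<forall>\<zeta><\<delta>. f \<zeta> = h \<zeta>" "f \<delta> < h \<delta>" using \<delta> \<epsilon> by auto
    with \<delta>(3) show ?thesis unfolding splits_in_def by blast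
  qed
qed

lemma base_fun_iff: "base_fun \<eta> A \<alpha> \<beta> \<longleftrightarrow> \<alpha> = \<beta> \<or> splits_in A (\<eta> \<alpha>) (\<eta> \<beta>)"
  by (auto simp: base_fun_def splits_in_iff)

lemma base_fun_refl: "base_fun \<eta> A \<alpha> \<alpha>"
  by (simp add: base_fun_def)

lemma base_fun_trans: "base_fun \<eta> A \<alpha> \<beta> \<Longrightarrow> base_fun \<eta> A \<beta> \<gamma> \<Longrightarrow> base_fun \<eta> A \<alpha> \<gamma>"
  unfolding base_fun_iff using splits_in_trans by metis

text \<open>The splitting point of \<open>f\<close> and \<open>g\<close> lies below \<open>\<gamma>\<close>, where \<open>g\<close> and \<open>g'\<close> agree.\<close>
lemma splits_in_restrict_cong:
  assumes "g |` {..<\<gamma>} = g' |` {..<\<gamma>}" "f |` {..<\<gamma>} \<noteq> g |` {..<\<gamma>}" "splits_in A f g"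
  shows "splits_in A f g'"
proof -
  obtain \<delta> where \<delta>: "\<forall>\<zeta><\<delta>. f \<zeta> = g \<zeta>" "f \<delta> < g \<delta>" "f |` {..<\<delta>} \<in> A"
    using assms(3) unfolding splits_in_def by blast
  have gg': "g \<zeta> = g' \<zeta>" if "\<zeta> < \<gamma>" for \<zeta>
    using fun_cong[OF assms(1), of \<zeta>] that by (simp add: restrict_map_def)
  have "\<delta> < \<gamma>"
  proof (rule ccontr)
    assume "\<not> \<delta> < \<gamma>"
    then have "f \<zeta> = g \<zeta>" if "\<zeta> < \<gamma>" for \<zeta> using \<delta>(1) that by auto
    then have "f |` {..<\<gamma>} = g |` {..<\<gamma>}" by (auto simp: restrict_map_def)
    with assms(2) show False by simp
  qed
  then have "\<forall>\<zeta><\<delta>. f \<zeta> = g' \<zeta>" "f \<delta> < g' \<delta>" using \<delta> gg' by auto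
  with \<delta>(3) show ?thesis unfolding splits_in_def by blast
qed

lemma base_fun_restrict_cong:
  assumes "\<eta> \<beta> |` {..<\<gamma>} = \<eta> \<beta>' |` {..<\<gamma>}" "\<eta> \<alpha> |` {..<\<gamma>} \<noteq> \<eta> \<beta> |` {..<\<gamma>}"
  shows "base_fun \<eta> A \<alpha> \<beta> \<longleftrightarrow> base_fun \<eta> A \<alpha> \<beta>'"
proof -
  have "\<alpha> \<noteq> \<beta>" "\<alpha> \<noteq> \<beta>'" using assms by auto
  then show ?thesis
    using splits_in_restrict_cong[OF assms] splits_in_restrict_cong[OF assms(1)[symmetric]] assms
    unfolding base_fun_iff by metis
qed


section \<open>Reduction to generators\<close>

locale branches = parameter +
  fixes \<eta> :: "'a \<Rightarrow> ('a \<rightharpoonup> 'a)" and A :: "('a \<rightharpoonup> 'a) set"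
  assumes prebase: "prebase \<mu> \<Lambda> \<chi> \<eta> A"
begin

lemma eta_seq: "\<alpha> < \<Lambda> \<Longrightarrow> \<eta> \<alpha> \<in> seqs_of_length \<mu> \<mu>"
  and eta_inj: "inj_on \<eta> {..<\<Lambda>}"
  using prebase unfolding prebase_def by auto

lemma same_block_unrelated:
  assumes "\<alpha> < \<Lambda>" "\<beta> < \<Lambda>" "block \<Lambda> \<chi> \<alpha> = block \<Lambda> \<chi> \<beta>" "base_fun \<eta> A \<alpha> \<beta>"
  shows "\<alpha> = \<beta>"
proof (rule ccontr)
  assume ne: "\<alpha> \<noteq> \<beta>"
  with assms(4) have s: "splits_in A (\<eta> \<alpha>) (\<eta> \<beta>)" by (simp add: base_fun_iff)
  have "common_init (\<eta> \<alpha>) (\<eta> \<beta>) \<in> A" "common_init (\<eta> \<beta>) (\<eta> \<alpha>) \<in> A"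
    using s splits_in_sym_common_init by (auto simp: splits_in_iff)
  then show False
    using prebase assms ne unfolding prebase_def by (metis linorder_neqE)
qed

lemma related_if_common_init:
  assumes "\<alpha> < \<Lambda>" "\<beta> < \<Lambda>" "\<alpha> \<noteq> \<beta>" "common_init (\<eta> \<alpha>) (\<eta> \<beta>) \<in> A"
  shows "if lex_less (\<eta> \<alpha>) (\<eta> \<beta>) then base_fun \<eta> A \<alpha> \<beta> else base_fun \<eta> A \<beta> \<alpha>"
proof -
  have "\<eta> \<alpha> \<noteq> \<eta> \<beta>" using assms(1-3) eta_inj by (auto dest: inj_onD)
  from common_init_cases[OF this assms(4)] show ?thesis
    using splits_in_not_lex[of A "\<eta> \<alpha>" "\<eta> \<beta>"] splits_in_not_lex[of A "\<eta> \<beta>" "\<eta> \<alpha>"]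
    by (auto simp: base_fun_iff)
qed

text \<open>
  Any two of the branches differ somewhere below \<open>\<mu>\<close>, and an infinite cardinal has no largest
  element, so it contains a strict upper bound of the finitely many places needed.
\<close>
lemma separating_length:
  assumes "finite v" "v \<subseteq> {..<\<Lambda>}"
  obtains \<gamma> where "\<gamma> < \<mu>" "inj_on (\<lambda>\<alpha>. \<eta> \<alpha> |` {..<\<gamma>}) v"
proof -
  have "\<exists>\<delta><\<mu>. \<eta> \<alpha> \<delta> \<noteq> \<eta> \<beta> \<delta>" if "\<alpha> < \<Lambda>" "\<beta> < \<Lambda>" "\<alpha> \<noteq> \<beta>" for \<alpha> \<beta>
  proof (rule ccontr)
    assume eq: "\<not> ?thesis"
    have "\<eta> \<alpha> \<delta> = \<eta> \<beta> \<delta>" for \<delta>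
    proof (cases "\<delta> < \<mu>")
      case False
      then have "\<delta> \<notin> dom (\<eta> \<alpha>)" "\<delta> \<notin> dom (\<eta> \<beta>)"
        using eta_seq that(1,2) by (auto simp: seqs_of_length_def)
      then show ?thesis by (simp add: domIff)
    qed (use eq in blast)
    then have "\<eta> \<alpha> = \<eta> \<beta>" by blast
    with that eta_inj show False by (auto dest: inj_onD)
  qed
  then obtain d where d: "\<And>\<alpha> \<beta>. \<alpha> < \<Lambda> \<Longrightarrow> \<beta> < \<Lambda> \<Longrightarrow> \<alpha> \<noteq> \<beta> \<Longrightarrow>
      d \<alpha> \<beta> < \<mu> \<and> \<eta> \<alpha> (d \<alpha> \<beta>) \<noteq> \<eta> \<beta> (d \<alpha> \<beta>)" by metis
  define D where "D = (\<lambda>(\<alpha>, \<beta>). d \<alpha> \<beta>) ` {p \<in> v \<times> v. fst p \<noteq> snd p}"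
  have D: "finite D" "D \<subseteq> {..<\<mu>}"
    using assms d by (fastforce simp: D_def)+
  have "\<exists>\<gamma><\<mu>. \<forall>\<delta>\<in>D. \<delta> < \<gamma>"
  proof (cases "D = {}")
    case True
    moreover have "{..<\<mu>} \<noteq> {}" using mu_infinite by auto
    ultimately show ?thesis by auto
  next
    case False
    then have "Max D < \<mu>" using D Max_in by auto
    then obtain \<gamma> where "\<gamma> < \<mu>" "Max D < \<gamma>"
      using infinite_cardinal_limit[OF mu_cardinal mu_infinite] by blast
    with D(1) False show ?thesis by auto
  qed
  then obtain \<gamma> where \<gamma>: "\<gamma> < \<mu>" "\<And>\<delta>. \<delta> \<in> D \<Longrightarrow> \<delta> < \<gamma>" by blast
  have "inj_on (\<lambda>\<alpha>. \<eta> \<alpha> |` {..<\<gamma>}) v"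
  proof (rule inj_onI, rule ccontr)
    fix \<alpha> \<beta> assume v: "\<alpha> \<in> v" "\<beta> \<in> v" and eq: "\<eta> \<alpha> |` {..<\<gamma>} = \<eta> \<beta> |` {..<\<gamma>}" and ne: "\<alpha> \<noteq> \<beta>"
    then have "d \<alpha> \<beta> < \<gamma>" by (intro \<gamma>(2)) (auto simp: D_def)
    then have "\<eta> \<alpha> (d \<alpha> \<beta>) = \<eta> \<beta> (d \<alpha> \<beta>)"
      using fun_cong[OF eq, of "d \<alpha> \<beta>"] by (simp add: restrict_map_def)
    with d v ne assms(2) show False by blast
  qed
  with \<gamma>(1) that show thesis by blast
qed

end

context branches
begin

text \<open>
  Here \<open>Q \<xi> \<zeta>\<close> says that the term \<open>t \<xi>\<close> must not lie below finite joins of such \<open>t \<zeta>\<close>; the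
  truth value \<open>s\<close> says whether the generators \<open>g \<xi>\<close> or their complements are found to be separated.
  Each term is replaced by the conjunction that fixes the trace of a suitable \<open>base_fun \<eta> A \<alpha>\<close> on
  its finitely many generators.  After colouring the indices by the shape of these traces below
  a separating length, the generators of different indices correspond to one another via the nodes
  \<open>\<rho>\<close> of a common finite set \<open>R\<close>.  If no single coordinate \<open>\<rho>\<close> separated \<open>\<xi>\<close>, each would be
  spoiled by some \<open>\<zeta>\<^sub>\<rho>\<close>; but a function that separates \<open>\<xi>\<close> from all \<open>\<zeta>\<^sub>\<rho>\<close> at once can use only the
  coordinate extended by \<open>\<eta> \<alpha>\<close>.
\<close>
lemma separated_generators:
  fixes t :: "'a \<Rightarrow> 'a bterm"
  assumes t: "\<And>\<xi>. \<xi> < \<Lambda> \<Longrightarrow> t \<xi> \<in> bterms {..<\<Lambda>}"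
    and sep: "\<And>\<xi> v. \<xi> < \<Lambda> \<Longrightarrow> finite v \<Longrightarrow> v \<subseteq> {\<zeta>. \<zeta> < \<Lambda> \<and> Q \<xi> \<zeta>} \<Longrightarrow>
      \<exists>\<alpha><\<Lambda>. holds (base_fun \<eta> A \<alpha>) (t \<xi>) \<and> (\<forall>\<zeta>\<in>v. \<not> holds (base_fun \<eta> A \<alpha>) (t \<zeta>))"
  obtains X g s where "X \<subseteq> {..<\<Lambda>}" "|{..<\<Lambda>}| \<le>o |X|" "g ` X \<subseteq> {..<\<Lambda>}"
    and "\<And>\<xi> \<zeta>. \<xi> \<in> X \<Longrightarrow> \<zeta> \<in> X \<Longrightarrow> Q \<xi> \<zeta> \<Longrightarrow>
      \<exists>\<alpha><\<Lambda>. base_fun \<eta> A \<alpha> (g \<xi>) = s \<and> base_fun \<eta> A \<alpha> (g \<zeta>) \<noteq> s"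
proof -
  let ?b = "base_fun \<eta> A"
  \<comment> \<open>The index \<open>\<xi>\<close> itself is included to make \<open>V \<xi>\<close> nonempty even if \<open>t \<xi>\<close> has no generators;
    so there is at least one coordinate.\<close>
  define V where "V \<xi> = insert \<xi> (set_bterm (t \<xi>))" for \<xi>
  have V: "finite (V \<xi>)" "V \<xi> \<noteq> {}" for \<xi>
    by (simp_all add: V_def finite_set_bterm)
  have VL: "V \<xi> \<subseteq> {..<\<Lambda>}" if "\<xi> < \<Lambda>" for \<xi>
    using t[OF that] that by (auto simp: V_def bterms_def)
  define trace where "trace \<alpha> \<xi> = {\<beta> \<in> V \<xi>. ?b \<alpha> \<beta>}" for \<alpha> \<xi>
  have trace_holds: "holds (?b \<alpha>) (t \<xi>) \<longleftrightarrow> holds (?b \<alpha>') (t \<xi>)"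
    if "trace \<alpha> \<xi> = trace \<alpha>' \<xi>" for \<alpha> \<alpha>' \<xi>
    by (rule holds_cong) (use that in \<open>auto simp: trace_def V_def\<close>)
  \<comment> \<open>Only finitely many traces occur on the finite set \<open>V \<xi>\<close>, so if every trace failed for
    some finite set, then all would fail for the union of these sets.\<close>
  let ?typical = "\<lambda>\<xi> p. p \<subseteq> V \<xi> \<and>
    (\<forall>v. finite v \<longrightarrow> v \<subseteq> {\<zeta>. \<zeta> < \<Lambda> \<and> Q \<xi> \<zeta>} \<longrightarrow>
      (\<exists>\<alpha><\<Lambda>. trace \<alpha> \<xi> = p \<and> holds (?b \<alpha>) (t \<xi>) \<and> (\<forall>\<zeta>\<in>v. \<not> holds (?b \<alpha>) (t \<zeta>))))"
  have typical: "\<exists>p. ?typical \<xi> p"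
    if \<xi>: "\<xi> < \<Lambda>" for \<xi>
  proof (rule ccontr)
    assume "\<not> ?thesis"
    then have "\<forall>p\<in>Pow (V \<xi>). \<exists>v. finite v \<and> v \<subseteq> {\<zeta>. \<zeta> < \<Lambda> \<and> Q \<xi> \<zeta>} \<and>
      \<not> (\<exists>\<alpha><\<Lambda>. trace \<alpha> \<xi> = p \<and> holds (?b \<alpha>) (t \<xi>) \<and> (\<forall>\<zeta>\<in>v. \<not> holds (?b \<alpha>) (t \<zeta>)))"
      by auto
    from bchoice[OF this] obtain v where v': "\<forall>p\<in>Pow (V \<xi>). finite (v p) \<and>
      v p \<subseteq> {\<zeta>. \<zeta> < \<Lambda> \<and> Q \<xi> \<zeta>} \<and> \<not> (\<exists>\<alpha><\<Lambda>. trace \<alpha> \<xi> = p \<and>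
        holds (?b \<alpha>) (t \<xi>) \<and> (\<forall>\<zeta>\<in>v p. \<not> holds (?b \<alpha>) (t \<zeta>)))" ..
    then have v: "\<And>p. p \<subseteq> V \<xi> \<Longrightarrow> finite (v p)" "\<And>p. p \<subseteq> V \<xi> \<Longrightarrow> v p \<subseteq> {\<zeta>. \<zeta> < \<Lambda> \<and> Q \<xi> \<zeta>}"
      "\<And>p \<alpha>. p \<subseteq> V \<xi> \<Longrightarrow> \<alpha> < \<Lambda> \<Longrightarrow> trace \<alpha> \<xi> = p \<Longrightarrow> holds (?b \<alpha>) (t \<xi>) \<Longrightarrow>
        \<exists>\<zeta>\<in>v p. holds (?b \<alpha>) (t \<zeta>)"
      by blast+
    have "finite (\<Union>p\<in>Pow (V \<xi>). v p)" "(\<Union>p\<in>Pow (V \<xi>). v p) \<subseteq> {\<zeta>. \<zeta> < \<Lambda> \<and> Q \<xi> \<zeta>}"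
      using V(1) v(1,2) by (simp, blast)
    from sep[OF \<xi> this] obtain \<alpha> where \<alpha>: "\<alpha> < \<Lambda>" "holds (?b \<alpha>) (t \<xi>)"
      "\<forall>\<zeta>\<in>(\<Union>p\<in>Pow (V \<xi>). v p). \<not> holds (?b \<alpha>) (t \<zeta>)" by blast
    have "trace \<alpha> \<xi> \<subseteq> V \<xi>" by (auto simp: trace_def)
    from v(3)[OF this \<alpha>(1) HOL.refl \<alpha>(2)] \<alpha>(3) \<open>trace \<alpha> \<xi> \<subseteq> V \<xi>\<close> show False by blast
  qed
  define p where "p \<xi> = (SOME p. ?typical \<xi> p)" for \<xi>
  have "?typical \<xi> (p \<xi>)" if "\<xi> < \<Lambda>" for \<xi>
    unfolding p_def by (rule someI_ex[OF typical[OF that]])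
  then have p: "\<And>\<xi>. \<xi> < \<Lambda> \<Longrightarrow> p \<xi> \<subseteq> V \<xi>"
    and p_holds: "\<And>\<xi> v. \<xi> < \<Lambda> \<Longrightarrow> finite v \<Longrightarrow> v \<subseteq> {\<zeta>. \<zeta> < \<Lambda> \<and> Q \<xi> \<zeta>} \<Longrightarrow>
      \<exists>\<alpha><\<Lambda>. trace \<alpha> \<xi> = p \<xi> \<and> holds (?b \<alpha>) (t \<xi>) \<and> (\<forall>\<zeta>\<in>v. \<not> holds (?b \<alpha>) (t \<zeta>))"
    by blast+
  have p_sep: "\<exists>\<alpha><\<Lambda>. trace \<alpha> \<xi> = p \<xi> \<and> (\<forall>\<zeta>\<in>v. trace \<alpha> \<zeta> \<noteq> p \<zeta>)"
    if \<xi>: "\<xi> < \<Lambda>" and v: "finite v" "v \<subseteq> {\<zeta>. \<zeta> < \<Lambda> \<and> Q \<xi> \<zeta>}" for \<xi> v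
  proof -
    obtain \<alpha> where \<alpha>: "\<alpha> < \<Lambda>" "trace \<alpha> \<xi> = p \<xi>" "\<forall>\<zeta>\<in>v. \<not> holds (?b \<alpha>) (t \<zeta>)"
      using p_holds[OF \<xi> v] by blast
    have "trace \<alpha> \<zeta> \<noteq> p \<zeta>" if "\<zeta> \<in> v" for \<zeta>
    proof
      assume eq: "trace \<alpha> \<zeta> = p \<zeta>"
      have "\<zeta> < \<Lambda>" using that v(2) by blast
      from p_holds[OF this, of "{}"] obtain \<alpha>' where "trace \<alpha>' \<zeta> = p \<zeta>" "holds (?b \<alpha>') (t \<zeta>)"
        by auto
      with eq have "holds (?b \<alpha>) (t \<zeta>)" using trace_holds[of \<alpha> \<zeta> \<alpha>'] by simp
      with \<alpha>(3) that show False by blast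
    qed
    with \<alpha> show ?thesis by blast
  qed
  define len where "len \<xi> = (SOME \<gamma>. \<gamma> < \<mu> \<and> inj_on (\<lambda>\<alpha>. \<eta> \<alpha> |` {..<\<gamma>}) (V \<xi>))" for \<xi>
  have len: "len \<xi> < \<mu> \<and> inj_on (\<lambda>\<alpha>. \<eta> \<alpha> |` {..<len \<xi>}) (V \<xi>)" if "\<xi> < \<Lambda>" for \<xi>
  proof -
    have "\<exists>\<gamma>. \<gamma> < \<mu> \<and> inj_on (\<lambda>\<alpha>. \<eta> \<alpha> |` {..<\<gamma>}) (V \<xi>)"
      by (rule separating_length[OF V(1) VL[OF that]]) blast
    then show ?thesis unfolding len_def by (rule someI_ex)
  qed
  \<comment> \<open>There are only \<open>\<mu>\<close> colours because \<open>\<mu>\<^sup><\<^sup>\<mu> = \<mu>\<close>.\<close>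
  define col where "col \<xi> = (len \<xi>, (\<lambda>\<alpha>. \<eta> \<alpha> |` {..<len \<xi>}) ` V \<xi>,
    (\<lambda>\<alpha>. \<eta> \<alpha> |` {..<len \<xi>}) ` p \<xi>)" for \<xi>
  let ?S = "seqs_shorter \<mu> \<mu>"
  let ?C = "{..<\<mu>} \<times> Fpow ?S \<times> Fpow ?S"
  have restr: "\<eta> \<alpha> |` {..<\<gamma>} \<in> ?S" if "\<alpha> < \<Lambda>" "\<gamma> < \<mu>" for \<alpha> \<gamma>
  proof -
    have "dom (\<eta> \<alpha>) = {..<\<mu>}" "ran (\<eta> \<alpha>) \<subseteq> {..<\<mu>}"
      using eta_seq[OF that(1)] by (simp_all add: seqs_of_length_def)
    moreover have "ran (\<eta> \<alpha> |` {..<\<gamma>}) \<subseteq> ran (\<eta> \<alpha>)"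
      unfolding ran_def restrict_map_def by (auto split: if_splits)
    ultimately have "\<eta> \<alpha> |` {..<\<gamma>} \<in> seqs_of_length \<mu> \<gamma>"
      using that(2) by (auto simp: seqs_of_length_def)
    with that(2) show ?thesis by (auto simp: seqs_shorter_def)
  qed
  have "col \<xi> \<in> ?C" if \<xi>: "\<xi> < \<Lambda>" for \<xi>
  proof -
    have "(\<lambda>\<alpha>. \<eta> \<alpha> |` {..<len \<xi>}) ` V \<xi> \<subseteq> ?S"
      using VL[OF \<xi>] conjunct1[OF len[OF \<xi>]] restr by auto
    then show ?thesis
      using p[OF \<xi>] V(1)[of \<xi>] finite_subset[OF p[OF \<xi>] V(1)] conjunct1[OF len[OF \<xi>]]
      by (auto simp: col_def Fpow_def)
  qed
  then have cover: "{..<\<Lambda>} \<subseteq> (\<Union>c\<in>?C. {\<xi>. \<xi> < \<Lambda> \<and> col \<xi> = c})" by auto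
  have "infinite ?S"
  proof
    assume "finite ?S"
    moreover have "|{..<\<mu>}| \<le>o |?S|" using card_mu_seqs by (rule ordIso_imp_ordLeq)
    ultimately show False using card_of_ordLeq_infinite mu_infinite by blast
  qed
  then have "|Fpow ?S| \<le>o |?S|" by (rule ordIso_imp_ordLeq[OF card_of_Fpow_infinite])
  then have F: "|Fpow ?S| \<le>o |{..<\<mu>}|" by (rule ordLeq_transitive[OF _ card_seqs_shorter])
  have "|?C| \<le>o |{..<\<mu>}|"
    using mu_infinite by (intro card_of_Times_ordLeq_infinite_Field F card_of_mono1) auto
  from pigeonhole[OF card_of_mono1[OF cover] this]
  obtain c where c: "|{..<\<Lambda>}| \<le>o |{\<xi>. \<xi> < \<Lambda> \<and> col \<xi> = c}|" by blast
  define X where "X = {\<xi>. \<xi> < \<Lambda> \<and> col \<xi> = c}"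
  obtain \<gamma> R P where "c = (\<gamma>, R, P)" by (cases c)
  then have X: "\<xi> < \<Lambda>" "len \<xi> = \<gamma>" "(\<lambda>\<alpha>. \<eta> \<alpha> |` {..<\<gamma>}) ` V \<xi> = R"
    "(\<lambda>\<alpha>. \<eta> \<alpha> |` {..<\<gamma>}) ` p \<xi> = P" if "\<xi> \<in> X" for \<xi>
    using that by (auto simp: X_def col_def)
  have inj: "inj_on (\<lambda>\<alpha>. \<eta> \<alpha> |` {..<\<gamma>}) (V \<xi>)" if "\<xi> \<in> X" for \<xi>
    using conjunct2[OF len[OF X(1)[OF that]]] X(2)[OF that] by simp
  \<comment> \<open>the generator of \<open>V \<xi>\<close> whose branch extends \<open>\<rho>\<close>; its sign is \<open>\<rho> \<in> P\<close>\<close>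
  define G where "G \<rho> \<xi> = the_inv_into (V \<xi>) (\<lambda>\<alpha>. \<eta> \<alpha> |` {..<\<gamma>}) \<rho>" for \<rho> \<xi>
  have G: "G \<rho> \<xi> \<in> V \<xi>" "\<eta> (G \<rho> \<xi>) |` {..<\<gamma>} = \<rho>" if "\<xi> \<in> X" "\<rho> \<in> R" for \<rho> \<xi>
    using the_inv_into_into[OF inj[OF that(1)], of \<rho> "V \<xi>"]
      f_the_inv_into_f[OF inj[OF that(1)], of \<rho>] X(3)[OF that(1)] that(2)
    by (simp_all add: G_def)
  have G_eq: "\<beta> = G (\<eta> \<beta> |` {..<\<gamma>}) \<xi>" "\<eta> \<beta> |` {..<\<gamma>} \<in> R" if "\<xi> \<in> X" "\<beta> \<in> V \<xi>" for \<xi> \<beta>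
    using the_inv_into_f_f[OF inj[OF that(1)] that(2)] X(3)[OF that(1)] that(2)
    by (auto simp: G_def)
  have GL: "G \<rho> \<xi> < \<Lambda>" if "\<xi> \<in> X" "\<rho> \<in> R" for \<rho> \<xi>
    using G(1)[OF that] VL[OF X(1)[OF that(1)]] by blast
  have G_in_p: "G \<rho> \<xi> \<in> p \<xi> \<longleftrightarrow> \<rho> \<in> P" if "\<xi> \<in> X" "\<rho> \<in> R" for \<rho> \<xi>
    using inj_on_image_mem_iff[OF inj[OF that(1)] G(1)[OF that] p[OF X(1)[OF that(1)]]]
      G(2)[OF that] X(4)[OF that(1)] by simp
  have trace_iff: "trace \<alpha> \<xi> = p \<xi> \<longleftrightarrow> (\<forall>\<rho>\<in>R. ?b \<alpha> (G \<rho> \<xi>) = (\<rho> \<in> P))" if \<xi>: "\<xi> \<in> X" for \<alpha> \<xi>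
  proof
    assume eq: "trace \<alpha> \<xi> = p \<xi>"
    show "\<forall>\<rho>\<in>R. ?b \<alpha> (G \<rho> \<xi>) = (\<rho> \<in> P)"
    proof
      fix \<rho> assume \<rho>: "\<rho> \<in> R"
      have "?b \<alpha> (G \<rho> \<xi>) \<longleftrightarrow> G \<rho> \<xi> \<in> trace \<alpha> \<xi>"
        using G(1)[OF \<xi> \<rho>] by (simp add: trace_def)
      then show "?b \<alpha> (G \<rho> \<xi>) = (\<rho> \<in> P)" using eq G_in_p[OF \<xi> \<rho>] by simp
    qed
  next
    assume *: "\<forall>\<rho>\<in>R. ?b \<alpha> (G \<rho> \<xi>) = (\<rho> \<in> P)"
    have "\<beta> \<in> trace \<alpha> \<xi> \<longleftrightarrow> \<beta> \<in> p \<xi>" if \<beta>: "\<beta> \<in> V \<xi>" for \<beta>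
    proof -
      let ?\<rho> = "\<eta> \<beta> |` {..<\<gamma>}"
      have "\<beta> \<in> trace \<alpha> \<xi> \<longleftrightarrow> ?b \<alpha> \<beta>" using \<beta> by (simp add: trace_def)
      also have "\<dots> \<longleftrightarrow> ?\<rho> \<in> P" using * G_eq[OF \<xi> \<beta>] by metis
      also have "\<dots> \<longleftrightarrow> \<beta> \<in> p \<xi>" using G_in_p[OF \<xi> G_eq(2)[OF \<xi> \<beta>]] G_eq(1)[OF \<xi> \<beta>] by simp
      finally show ?thesis .
    qed
    moreover have "trace \<alpha> \<xi> \<subseteq> V \<xi>" by (auto simp: trace_def)
    ultimately show "trace \<alpha> \<xi> = p \<xi>" using p[OF X(1)[OF \<xi>]] by blast
  qed
  \<comment> \<open>the indices that coordinate \<open>\<rho>\<close> alone separates from all others\<close>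
  define sepd where "sepd \<rho> = {\<xi> \<in> X. \<forall>\<zeta>\<in>X. Q \<xi> \<zeta> \<longrightarrow>
    (\<exists>\<alpha><\<Lambda>. ?b \<alpha> (G \<rho> \<xi>) = (\<rho> \<in> P) \<and> ?b \<alpha> (G \<rho> \<zeta>) \<noteq> (\<rho> \<in> P))}" for \<rho>
  have "X \<subseteq> (\<Union>\<rho>\<in>R. sepd \<rho>)"
  proof (rule subsetI, rule ccontr)
    fix \<xi> assume \<xi>: "\<xi> \<in> X" and none: "\<xi> \<notin> (\<Union>\<rho>\<in>R. sepd \<rho>)"
    have "\<forall>\<rho>\<in>R. \<exists>\<zeta>. \<zeta> \<in> X \<and> Q \<xi> \<zeta> \<and> (\<forall>\<alpha><\<Lambda>. ?b \<alpha> (G \<rho> \<xi>) = (\<rho> \<in> P) \<longrightarrow> ?b \<alpha> (G \<rho> \<zeta>) = (\<rho> \<in> P))"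
      using none \<xi> unfolding sepd_def by blast
    from bchoice[OF this] obtain z where z: "\<And>\<rho>. \<rho> \<in> R \<Longrightarrow> z \<rho> \<in> X" "\<And>\<rho>. \<rho> \<in> R \<Longrightarrow> Q \<xi> (z \<rho>)"
      "\<And>\<rho> \<alpha>. \<rho> \<in> R \<Longrightarrow> \<alpha> < \<Lambda> \<Longrightarrow> ?b \<alpha> (G \<rho> \<xi>) = (\<rho> \<in> P) \<Longrightarrow> ?b \<alpha> (G \<rho> (z \<rho>)) = (\<rho> \<in> P)"
      by blast
    have R: "finite R" "R \<noteq> {}" using X(3)[OF \<xi>] V by auto
    have "finite (z ` R)" "z ` R \<subseteq> {\<zeta>. \<zeta> < \<Lambda> \<and> Q \<xi> \<zeta>}"
      using R(1) z(1,2) X(1) by auto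
    from p_sep[OF X(1)[OF \<xi>] this] obtain \<alpha> where \<alpha>: "\<alpha> < \<Lambda>" "trace \<alpha> \<xi> = p \<xi>"
      "\<forall>\<rho>\<in>R. trace \<alpha> (z \<rho>) \<noteq> p (z \<rho>)" by blast
    \<comment> \<open>\<open>\<eta> \<alpha>\<close> extends at most one element of \<open>R\<close>; all other coordinates cannot tell \<open>\<xi>\<close> from
      any other index.\<close>
    obtain \<rho> where \<rho>: "\<rho> \<in> R" "\<eta> \<alpha> |` {..<\<gamma>} \<in> R \<longrightarrow> \<rho> = \<eta> \<alpha> |` {..<\<gamma>}"
      using R(2) by (cases "\<eta> \<alpha> |` {..<\<gamma>} \<in> R") auto
    have "?b \<alpha> (G \<rho>' (z \<rho>)) = (\<rho>' \<in> P)" if \<rho>': "\<rho>' \<in> R" for \<rho>'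
    proof (cases "\<rho>' = \<rho>")
      case True
      then show ?thesis
        using z(3)[OF \<rho>(1) \<alpha>(1)] trace_iff[OF \<xi>] \<alpha>(2) \<rho>' by blast
    next
      case False
      with \<rho>(2) \<rho>' have "\<eta> \<alpha> |` {..<\<gamma>} \<noteq> \<rho>'" by blast
      then have "?b \<alpha> (G \<rho>' \<xi>) = ?b \<alpha> (G \<rho>' (z \<rho>))"
        using G(2)[OF \<xi> \<rho>'] G(2)[OF z(1)[OF \<rho>(1)] \<rho>']
        by (intro base_fun_restrict_cong[where \<gamma> = \<gamma>]) auto
      then show ?thesis using trace_iff[OF \<xi>] \<alpha>(2) \<rho>' by blast
    qed
    then have "trace \<alpha> (z \<rho>) = p (z \<rho>)" using trace_iff[OF z(1)[OF \<rho>(1)]] by blast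
    with \<alpha>(3) \<rho>(1) show False by blast
  qed
  then have big: "|{..<\<Lambda>}| \<le>o |\<Union>\<rho>\<in>R. sepd \<rho>|"
    by (rule ordLeq_transitive[OF c[folded X_def] card_of_mono1])
  have "X \<noteq> {}"
    using card_of_ordLeq_infinite[OF c[folded X_def] Lambda_infinite] by auto
  then have "finite R" using X(3) V(1) by blast
  then have "|R| \<le>o |{..<\<mu>}|"
    by (rule ordLess_imp_ordLeq[OF finite_ordLess_infinite2[OF _ mu_infinite]])
  from pigeonhole[OF big this] obtain \<rho> where \<rho>: "\<rho> \<in> R" "|{..<\<Lambda>}| \<le>o |sepd \<rho>|" by blast
  show thesis
  proof (rule that[OF _ \<rho>(2), of "G \<rho>" "\<rho> \<in> P"])
    show "sepd \<rho> \<subseteq> {..<\<Lambda>}" "G \<rho> ` sepd \<rho> \<subseteq> {..<\<Lambda>}"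
      using X(1) GL[OF _ \<rho>(1)] by (auto simp: sepd_def)
  qed (auto simp: sepd_def)
qed

end


section \<open>Sizes and suprema\<close>

text \<open>The terms over \<open>w\<close> of height at most \<open>n\<close>.\<close>
primrec bterm_layer :: "'a set \<Rightarrow> nat \<Rightarrow> 'a bterm set" where
  "bterm_layer w 0 = {Zero, One} \<union> Gen ` w"
| "bterm_layer w (Suc n) = bterm_layer w n \<union> Compl ` bterm_layer w n \<union>
    (\<lambda>(s, t). Meet s t) ` (bterm_layer w n \<times> bterm_layer w n) \<union>
    (\<lambda>(s, t). Join s t) ` (bterm_layer w n \<times> bterm_layer w n)"

lemma bterm_layer_mono: "m \<le> n \<Longrightarrow> bterm_layer w m \<subseteq> bterm_layer w n"
  by (rule lift_Suc_mono_le[of "bterm_layer w"]) auto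

lemma bterms_layers: "bterms w \<subseteq> (\<Union>n. bterm_layer w n)"
proof
  fix s assume "s \<in> bterms w"
  then have "set_bterm s \<subseteq> w" by (simp add: bterms_def)
  then have "\<exists>n. s \<in> bterm_layer w n"
  proof (induction s)
    case (Gen a)
    then show ?case by (auto intro!: exI[of _ 0])
  next
    case Zero
    show ?case by (rule exI[of _ 0]) simp
  next
    case One
    show ?case by (rule exI[of _ 0]) simp
  next
    case (Compl s)
    then obtain n where "s \<in> bterm_layer w n" by auto
    then show ?case by (intro exI[of _ "Suc n"]) simp
  next
    case (Meet s t)
    then obtain m n where "s \<in> bterm_layer w m" "t \<in> bterm_layer w n" by auto
    then have "s \<in> bterm_layer w (max m n)" "t \<in> bterm_layer w (max m n)"
      using bterm_layer_mono[of m "max m n" w] bterm_layer_mono[of n "max m n" w] by auto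
    then show ?case by (intro exI[of _ "Suc (max m n)"]) (simp add: image_iff)
  next
    case (Join s t)
    then obtain m n where "s \<in> bterm_layer w m" "t \<in> bterm_layer w n" by auto
    then have "s \<in> bterm_layer w (max m n)" "t \<in> bterm_layer w (max m n)"
      using bterm_layer_mono[of m "max m n" w] bterm_layer_mono[of n "max m n" w] by auto
    then show ?case by (intro exI[of _ "Suc (max m n)"]) (simp add: image_iff)
  qed
  then show "s \<in> (\<Union>n. bterm_layer w n)" by blast
qed

lemma card_bterms:
  assumes w: "infinite w"
  shows "|bterms w| \<le>o |w|"
proof -
  have C: "Cinfinite |w|" using w by (simp add: cinfinite_def)
  have times: "|A \<times> B| \<le>o |w|" if "|A| \<le>o |w|" "|B| \<le>o |w|" for A :: "'a bterm set" and B :: "'a bterm set"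
    using w that by (intro card_of_Times_ordLeq_infinite_Field) auto
  have image: "|f ` B| \<le>o |w|" if "|B| \<le>o |w|" for f :: "'c \<Rightarrow> 'a bterm" and B
    by (rule ordLeq_transitive[OF card_of_image that])
  have "|bterm_layer w n| \<le>o |w|" for n
  proof (induction n)
    case 0
    have "|{Zero, One :: 'a bterm}| \<le>o |w|"
      using w by (intro ordLess_imp_ordLeq finite_ordLess_infinite2) auto
    moreover have "|Gen ` w| \<le>o |w|" by (rule card_of_image)
    ultimately show ?case using C by (simp only: bterm_layer.simps Un_Cinfinite_bound)
  next
    case (Suc n)
    show ?case
      unfolding bterm_layer.simps by (intro Un_Cinfinite_bound image times Suc C)
  qed
  moreover have "|UNIV :: nat set| \<le>o |w|"
    using w infinite_iff_card_of_nat by blast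
  ultimately have "|\<Union>n. bterm_layer w n| \<le>o |w|"
    by (intro card_of_UNION_ordLeq_infinite[OF w]) auto
  then show ?thesis
    by (rule ordLeq_transitive[OF card_of_mono1[OF bterms_layers]])
qed

lemma card_presented_ba:
  assumes "infinite w"
  shows "|carrier (presented_ba w F)| \<le>o |w|"
proof -
  have "carrier (presented_ba w F) = (\<lambda>t. bequiv_rel w F `` {t}) ` bterms w"
    using presented_ba_carrier by blast
  then show ?thesis
    using ordLeq_transitive[OF card_of_image card_bterms[OF assms]] by simp
qed

context parameter
begin

text \<open>
  Suprema are taken among the cardinals on the type of the members of \<open>K\<close>; the injection \<open>e\<close>
  provides a copy of \<open>\<Lambda>\<close> there.
\<close>
lemma card_Sup_eq:
  fixes K :: "'c rel set" and e :: "'a \<Rightarrow> 'c"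
  assumes card: "\<And>\<kappa>. \<kappa> \<in> K \<Longrightarrow> Card_order \<kappa>"
    and upper: "\<And>\<kappa>. \<kappa> \<in> K \<Longrightarrow> \<kappa> \<le>o |{..<\<Lambda>}|"
    and lower: "\<And>i. i < \<theta> \<Longrightarrow> \<exists>\<kappa>\<in>K. |{..<\<chi> i}| \<le>o \<kappa>"
    and e: "inj e"
  shows "card_Sup K =o |{..<\<Lambda>}|"
proof -
  have sup: "is_card_Sup K (card_Sup K)" by (rule card_Sup) (rule card)
  have iso: "|e ` {..<\<Lambda>}| =o |{..<\<Lambda>}|"
    by (rule ordIso_symmetric[OF card_of_ordIsoI[OF inj_on_imp_bij_betw[OF inj_on_subset[OF e]]]]) simp
  have "\<kappa> \<le>o |e ` {..<\<Lambda>}|" if "\<kappa> \<in> K" for \<kappa>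
    by (rule ordLeq_ordIso_trans[OF upper[OF that] ordIso_symmetric[OF iso]])
  then have "card_Sup K \<le>o |e ` {..<\<Lambda>}|"
    using sup card_of_Card_order unfolding is_card_Sup_def by blast
  then have "card_Sup K \<le>o |{..<\<Lambda>}|"
    by (rule ordLeq_ordIso_trans[OF _ iso])
  moreover have "|{..<\<Lambda>}| \<le>o card_Sup K"
  proof (rule Lambda_ordLeqI)
    show "Well_order (card_Sup K)"
      using sup card_order_on_well_order_on unfolding is_card_Sup_def by blast
    fix i assume "i < \<theta>"
    then obtain \<kappa> where "\<kappa> \<in> K" "|{..<\<chi> i}| \<le>o \<kappa>" using lower by blast
    moreover have "\<kappa> \<le>o card_Sup K" using sup \<open>\<kappa> \<in> K\<close> unfolding is_card_Sup_def by blast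
    ultimately show "|{..<\<chi> i}| \<le>o card_Sup K" by (rule_tac ordLeq_transitive)
  qed
  ultimately show ?thesis by (simp add: ordIso_iff_ordLeq)
qed

text \<open>
  The block is what remains of the infinite cardinal \<open>\<chi> (ord_succ i)\<close> after removing a smaller
  initial segment.
\<close>
lemma card_block:
  assumes i: "i < \<theta>"
  shows "|{..<\<chi> i}| \<le>o |{\<chi> i..<\<chi> (ord_succ i)}|"
proof -
  let ?s = "ord_succ i"
  have s: "?s < \<theta>" and lt: "\<chi> i < \<chi> ?s"
    using i succ_less_cof chi_less_iff less_ord_succ by blast+
  have "ord_succ ord_zero \<le> ?s"
    using ord_zero_le[of i] less_ord_succ[OF i] by (intro ord_succ_le) (rule le_less_trans)
  then have "\<theta> \<le> \<chi> ?s"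
    using cof_less_chi chi_le_iff[of "ord_succ ord_zero" ?s] s by (meson le_less_trans less_le_trans less_imp_le)
  then have inf: "infinite {..<\<chi> ?s}"
    using mu_infinite mu_less by (meson finite_subset lessThan_subset_iff less_imp_le order.trans)
  have "\<not> |{\<chi> i..<\<chi> ?s}| <o |{..<\<chi> ?s}|"
  proof
    assume "|{\<chi> i..<\<chi> ?s}| <o |{..<\<chi> ?s}|"
    moreover have "|{..<\<chi> i}| <o |{..<\<chi> ?s}|"
      using chi_cardinal[OF s] lt unfolding is_cardinal_def by blast
    ultimately have "|{..<\<chi> i} \<union> {\<chi> i..<\<chi> ?s}| <o |{..<\<chi> ?s}|"
      using card_of_Un_ordLess_infinite[OF inf] by blast
    moreover have "{..<\<chi> i} \<union> {\<chi> i..<\<chi> ?s} = {..<\<chi> ?s}"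
      using lt by (intro ivl_disj_un_one) simp
    ultimately show False using ordLess_irreflexive by metis
  qed
  then have "|{..<\<chi> ?s}| \<le>o |{\<chi> i..<\<chi> ?s}|"
    using not_ordLess_iff_ordLeq[of "|{\<chi> i..<\<chi> ?s}|" "|{..<\<chi> ?s}|"] by (simp add: card_of_Well_order)
  then show ?thesis
    by (rule ordLeq_transitive[OF card_lessThan_mono[OF less_imp_le[OF lt]]])
qed

end


section \<open>The cardinal invariants\<close>

lemma Card_order_total:
  assumes "Card_order \<kappa>" "\<xi> \<in> Field \<kappa>" "\<zeta> \<in> Field \<kappa>" "\<xi> \<noteq> \<zeta>"
  shows "\<zeta> \<in> aboveS \<kappa> \<xi> \<or> \<xi> \<in> aboveS \<kappa> \<zeta>" "\<zeta> \<in> underS \<kappa> \<xi> \<or> \<xi> \<in> underS \<kappa> \<zeta>"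
proof -
  have "total_on (Field \<kappa>) \<kappa>"
    using assms(1) unfolding card_order_on_def well_order_on_def linear_order_on_def by blast
  then have "(\<xi>, \<zeta>) \<in> \<kappa> \<or> (\<zeta>, \<xi>) \<in> \<kappa>"
    using assms(2-4) unfolding total_on_def by blast
  then show "\<zeta> \<in> aboveS \<kappa> \<xi> \<or> \<xi> \<in> aboveS \<kappa> \<zeta>" "\<zeta> \<in> underS \<kappa> \<xi> \<or> \<xi> \<in> underS \<kappa> \<zeta>"
    using assms(4) by (auto simp: aboveS_def underS_def)
qed

lemma ordLeq_of_inj_on:
  assumes "Card_order \<kappa>" "inj_on a (Field \<kappa>)" "a ` Field \<kappa> \<subseteq> C" "|C| \<le>o r"
  shows "\<kappa> \<le>o r"
proof -
  have "|Field \<kappa>| \<le>o |C|" using assms(2,3) card_of_ordLeq by blast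
  then have "|Field \<kappa>| \<le>o r" by (rule ordLeq_transitive[OF _ assms(4)])
  then show ?thesis
    by (rule ordIso_ordLeq_trans[OF ordIso_symmetric[OF card_of_Field_ordIso[OF assms(1)]]])
qed

lemma separated_length:
  assumes "Card_order \<kappa>" and sep: "separated (presented_ba w F) \<kappa> W a" and "infinite w"
    and "\<And>\<xi> \<zeta>. \<xi> \<in> Field \<kappa> \<Longrightarrow> \<zeta> \<in> Field \<kappa> \<Longrightarrow> \<xi> \<noteq> \<zeta> \<Longrightarrow> \<zeta> \<in> W \<xi> \<or> \<xi> \<in> W \<zeta>"
  shows "\<kappa> \<le>o |w|"
  by (rule ordLeq_of_inj_on[OF assms(1) separated_inj_on[OF sep assms(4)] separated_carrier[OF sep]
        card_presented_ba[OF assms(3)]])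

context branches
begin

abbreviation algebra :: "'a bterm set gorder"
  where "algebra \<equiv> base_algebra \<Lambda> \<eta> A"

text \<open>
  The witnesses are the generators of block \<open>i\<close>: \<open>base_fun \<eta> A \<alpha>\<close> satisfies the generator \<open>\<alpha>\<close> and,
  by clause (b), no other generator of the block.
\<close>
lemma block_ideal_independent:
  assumes i: "i < \<theta>"
  obtains \<kappa> :: "'a bterm set rel" and a
  where "Card_order \<kappa>" "ideal_independent algebra \<kappa> a" "|{..<\<chi> i}| \<le>o \<kappa>"
proof -
  let ?B = "{\<chi> i..<\<chi> (ord_succ i)}" and ?F = "base_fun \<eta> A ` {..<\<Lambda>}"
  define c where "c \<alpha> = bequiv_rel {..<\<Lambda>} ?F `` {Gen \<alpha>}" for \<alpha>
  have BL: "\<alpha> < \<Lambda>" if "\<alpha> \<in> ?B" for \<alpha>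
    using that chi_less[OF succ_less_cof[OF i]] by auto
  have gen: "Gen \<alpha> \<in> bterms {..<\<Lambda>}" if "\<alpha> \<in> ?B" for \<alpha>
    using BL[OF that] by (simp add: bterms_def)
  have same: "block \<Lambda> \<chi> \<alpha> = i" if "\<alpha> \<in> ?B" for \<alpha>
    using block_eq[OF i] that by simp
  have indep: "\<not> c \<alpha> \<sqsubseteq>\<^bsub>algebra\<^esub> \<Squnion>\<^bsub>algebra\<^esub> (c ` U)"
    if \<alpha>: "\<alpha> \<in> ?B" and U: "finite U" "U \<subseteq> ?B" "\<alpha> \<notin> U" for \<alpha> U
  proof -
    have cU: "c ` U = (\<lambda>t. bequiv_rel {..<\<Lambda>} ?F `` {t}) ` (Gen ` U)"
      by (simp add: image_image c_def)
    have "Gen ` U \<subseteq> bterms {..<\<Lambda>}" using gen U(2) by blast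
    note iff = presented_ba_le_join_iff[OF gen[OF \<alpha>] finite_imageI[OF U(1)] this, of ?F]
    have "\<not> base_fun \<eta> A \<alpha> \<beta>" if \<beta>: "\<beta> \<in> U" for \<beta>
      using same_block_unrelated[of \<alpha> \<beta>] \<alpha> \<beta> U(2,3) BL same by (metis subsetD)
    then have "\<not> (\<forall>f\<in>?F. holds f (Gen \<alpha>) \<longrightarrow> (\<exists>t\<in>Gen ` U. holds f t))"
      using BL[OF \<alpha>] base_fun_refl[of \<eta> A \<alpha>] by auto
    then show ?thesis
      using iff unfolding base_algebra_def cU c_def by blast
  qed
  have inj: "inj_on c ?B"
  proof (rule inj_onI, rule ccontr)
    fix \<alpha> \<beta> assume \<alpha>: "\<alpha> \<in> ?B" and \<beta>: "\<beta> \<in> ?B" and eq: "c \<alpha> = c \<beta>" and ne: "\<alpha> \<noteq> \<beta>"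
    have "c \<alpha> \<sqsubseteq>\<^bsub>algebra\<^esub> \<Squnion>\<^bsub>algebra\<^esub> (c ` {\<alpha>})"
      using presented_ba_le_join_iff[OF gen[OF \<alpha>], of "{Gen \<alpha>}" ?F] gen[OF \<alpha>]
      by (simp add: base_algebra_def c_def)
    then have "c \<alpha> \<sqsubseteq>\<^bsub>algebra\<^esub> \<Squnion>\<^bsub>algebra\<^esub> (c ` {\<beta>})"
      by (simp add: eq)
    with indep[OF \<alpha>, of "{\<beta>}"] \<beta> ne show False by simp
  qed
  have "ideal_independent algebra |c ` ?B| id"
    unfolding ideal_independent_def
  proof (intro conjI ballI allI impI)
    have "c \<alpha> \<in> carrier algebra" if "\<alpha> \<in> ?B" for \<alpha>
      unfolding base_algebra_def presented_ba_carrier c_def using gen[OF that] by blast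
    then show "id ` Field |c ` ?B| \<subseteq> carrier algebra" by auto
  next
    fix \<xi> W assume "\<xi> \<in> Field |c ` ?B|" and W: "finite W \<and> W \<subseteq> Field |c ` ?B| - {\<xi>}"
    then obtain \<alpha> where \<alpha>: "\<alpha> \<in> ?B" "\<xi> = c \<alpha>" by auto
    obtain U where U: "U \<subseteq> ?B" "finite U" "W = c ` U"
      using finite_subset_image[of W c ?B] W by auto
    have "\<alpha> \<notin> U" using U(3) W \<alpha>(2) by auto
    from indep[OF \<alpha>(1) U(2,1) this] show "\<not> id \<xi> \<sqsubseteq>\<^bsub>algebra\<^esub> \<Squnion>\<^bsub>algebra\<^esub> (id ` W)"
      by (simp add: \<alpha>(2) U(3))
  qed
  moreover have "|?B| =o |c ` ?B|"
    by (rule card_of_ordIsoI[OF inj_on_imp_bij_betw[OF inj]])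
  then have "|{..<\<chi> i}| \<le>o |c ` ?B|"
    by (rule ordLeq_ordIso_trans[OF card_block[OF i]])
  ultimately show thesis
    using that[OF card_of_Card_order] by blast
qed

text \<open>
  If \<open>g \<xi> \<preceq> g \<zeta>\<close>, then by transitivity every \<open>base_fun \<eta> A \<alpha>\<close> that satisfies \<open>g \<xi>\<close> satisfies
  \<open>g \<zeta>\<close>, so that the generators are not separated; for complements the relation is reversed.
\<close>
lemma separated_imp_unrelated:
  assumes sep: "separated algebra \<kappa> W a" and W: "\<And>\<xi>. W \<xi> \<subseteq> Field \<kappa>"
    and h: "h ` {..<\<Lambda>} \<subseteq> Field \<kappa>"
    and Q: "\<And>\<xi> \<zeta>. \<xi> < \<Lambda> \<Longrightarrow> \<zeta> < \<Lambda> \<Longrightarrow> Q \<xi> \<zeta> \<Longrightarrow> h \<zeta> \<in> W (h \<xi>)"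
  obtains X g s where "X \<subseteq> {..<\<Lambda>}" "|{..<\<Lambda>}| \<le>o |X|" "g ` X \<subseteq> {..<\<Lambda>}"
    and "\<forall>\<xi>\<in>X. \<forall>\<zeta>\<in>X. Q \<xi> \<zeta> \<longrightarrow>
      (if s then \<not> base_fun \<eta> A (g \<xi>) (g \<zeta>) else \<not> base_fun \<eta> A (g \<zeta>) (g \<xi>))"
proof -
  obtain t where t: "\<forall>\<xi>\<in>Field \<kappa>. t \<xi> \<in> bterms {..<\<Lambda>}"
    "\<forall>\<xi>\<in>Field \<kappa>. \<forall>v. finite v \<and> v \<subseteq> W \<xi> \<longrightarrow>
      (\<exists>f\<in>base_fun \<eta> A ` {..<\<Lambda>}. holds f (t \<xi>) \<and> (\<forall>\<zeta>\<in>v. \<not> holds f (t \<zeta>)))"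
    using separated_terms[OF sep[unfolded base_algebra_def] W] by (elim exE conjE)
  have hF: "h \<xi> \<in> Field \<kappa>" if "\<xi> < \<Lambda>" for \<xi> using h that by auto
  have "t (h \<xi>) \<in> bterms {..<\<Lambda>}" if "\<xi> < \<Lambda>" for \<xi> by (rule bspec[OF t(1) hF[OF that]])
  moreover have "\<exists>\<alpha><\<Lambda>. holds (base_fun \<eta> A \<alpha>) (t (h \<xi>)) \<and>
      (\<forall>\<zeta>\<in>v. \<not> holds (base_fun \<eta> A \<alpha>) (t (h \<zeta>)))"
    if \<xi>: "\<xi> < \<Lambda>" and v: "finite v" "v \<subseteq> {\<zeta>. \<zeta> < \<Lambda> \<and> Q \<xi> \<zeta>}" for \<xi> v
  proof -
    have "h ` v \<subseteq> W (h \<xi>)" using v(2) Q[OF \<xi>] by auto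
    then have "finite (h ` v) \<and> h ` v \<subseteq> W (h \<xi>)" using v(1) by simp
    from mp[OF spec[OF bspec[OF t(2) hF[OF \<xi>]]] this] show ?thesis by (simp add: Bex_def)
  qed
  ultimately obtain X g s where X: "X \<subseteq> {..<\<Lambda>}" "|{..<\<Lambda>}| \<le>o |X|" "g ` X \<subseteq> {..<\<Lambda>}"
    and *: "\<And>\<xi> \<zeta>. \<xi> \<in> X \<Longrightarrow> \<zeta> \<in> X \<Longrightarrow> Q \<xi> \<zeta> \<Longrightarrow>
      \<exists>\<alpha><\<Lambda>. base_fun \<eta> A \<alpha> (g \<xi>) = s \<and> base_fun \<eta> A \<alpha> (g \<zeta>) \<noteq> s"
    by (rule separated_generators[of "\<lambda>\<xi>. t (h \<xi>)" Q]) auto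
  show thesis
  proof (rule that[OF X, of s], intro ballI impI)
    fix \<xi> \<zeta> assume "\<xi> \<in> X" "\<zeta> \<in> X" "Q \<xi> \<zeta>"
    from *[OF this] obtain \<alpha> where "base_fun \<eta> A \<alpha> (g \<xi>) = s" "base_fun \<eta> A \<alpha> (g \<zeta>) \<noteq> s" by blast
    then show "if s then \<not> base_fun \<eta> A (g \<xi>) (g \<zeta>) else \<not> base_fun \<eta> A (g \<zeta>) (g \<xi>)"
      using base_fun_trans[of \<eta> A \<alpha> "g \<xi>" "g \<zeta>"] base_fun_trans[of \<eta> A \<alpha> "g \<zeta>" "g \<xi>"] by auto
  qed
qed

lemma large_image_ordIso:
  assumes "|{..<\<Lambda>}| \<le>o |Z|" "inj_on g Z" "g ` Z \<subseteq> {..<\<Lambda>}"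
  shows "|g ` Z| =o |{..<\<Lambda>}|"
proof -
  have "|Z| =o |g ` Z|"
    by (rule card_of_ordIsoI[OF inj_on_imp_bij_betw[OF assms(2)]])
  then have "|{..<\<Lambda>}| \<le>o |g ` Z|" by (rule ordLeq_ordIso_trans[OF assms(1)])
  with card_of_mono1[OF assms(3)] show ?thesis by (simp add: ordIso_iff_ordLeq)
qed

lemma no_long_ideal_independent:
  fixes \<kappa> :: "'k rel"
  assumes base: "base \<mu> \<Lambda> \<chi> \<eta> A" and ind: "ideal_independent algebra \<kappa> a"
  shows "\<not> |{..<\<Lambda>}| \<le>o \<kappa>"
proof
  assume "|{..<\<Lambda>}| \<le>o \<kappa>"
  then obtain h where h: "h ` {..<\<Lambda>} \<subseteq> Field \<kappa>"
    "\<forall>\<zeta><\<Lambda>. \<forall>\<xi><\<zeta>. h \<xi> \<noteq> h \<zeta> \<and> (h \<xi>, h \<zeta>) \<in> \<kappa>"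
    by (rule cardinal_embedding[OF Lambda_cardinal])
  have hW: "h \<zeta> \<in> Field \<kappa> - {h \<xi>}" if "\<xi> < \<Lambda>" "\<zeta> < \<Lambda>" "\<xi> \<noteq> \<zeta>" for \<xi> \<zeta>
  proof -
    have "h \<xi> \<noteq> h \<zeta>" using h(2) that by (metis linorder_neqE)
    with h(1) that(2) show ?thesis by auto
  qed
  from separated_imp_unrelated[OF ind[unfolded ideal_independent_iff] Diff_subset h(1), of "(\<noteq>)", OF hW]
  obtain X g s where X: "X \<subseteq> {..<\<Lambda>}" "|{..<\<Lambda>}| \<le>o |X|" "g ` X \<subseteq> {..<\<Lambda>}"
    and *: "\<forall>\<xi>\<in>X. \<forall>\<zeta>\<in>X. \<xi> \<noteq> \<zeta> \<longrightarrow>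
      (if s then \<not> base_fun \<eta> A (g \<xi>) (g \<zeta>) else \<not> base_fun \<eta> A (g \<zeta>) (g \<xi>))"
    by blast
  have unrelated: "\<not> base_fun \<eta> A (g \<xi>) (g \<zeta>)" if "\<xi> \<in> X" "\<zeta> \<in> X" "\<xi> \<noteq> \<zeta>" for \<xi> \<zeta>
    using * that by (cases s) auto
  have "inj_on g X"
  proof (rule inj_onI, rule ccontr)
    fix \<xi> \<zeta> assume "\<xi> \<in> X" "\<zeta> \<in> X" "g \<xi> = g \<zeta>" "\<xi> \<noteq> \<zeta>"
    with unrelated[of \<xi> \<zeta>] base_fun_refl[of \<eta> A "g \<xi>"] show False by simp
  qed
  then have "|g ` X| =o |{..<\<Lambda>}|" by (rule large_image_ordIso[OF X(2) _ X(3)])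
  then obtain \<alpha> \<beta> where ab: "\<alpha> \<in> g ` X" "\<beta> \<in> g ` X" "\<alpha> \<noteq> \<beta>" "common_init (\<eta> \<alpha>) (\<eta> \<beta>) \<in> A"
    using base X(3) unfolding base_def by blast
  then have "\<alpha> < \<Lambda>" "\<beta> < \<Lambda>" using X(3) by auto
  from related_if_common_init[OF this ab(3,4)]
  have "base_fun \<eta> A \<alpha> \<beta> \<or> base_fun \<eta> A \<beta> \<alpha>" by (simp split: if_splits)
  with ab(1-3) unrelated show False by auto
qed

text \<open>
  Clause (c\<open>\<^sup>+\<close>) is applied to the values of \<open>g\<close> on a set where \<open>g\<close> is increasing across blocks, with
  the direction \<open>t\<close> that yields the relation excluded by \<open>s\<close>.
\<close>
lemma no_monotone_unrelated:
  assumes base: "base_plus \<mu> \<Lambda> \<chi> \<eta> A"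
    and X: "X \<subseteq> {..<\<Lambda>}" "|{..<\<Lambda>}| \<le>o |X|" "g ` X \<subseteq> {..<\<Lambda>}"
    and un: "\<And>\<xi> \<zeta>. \<xi> \<in> X \<Longrightarrow> \<zeta> \<in> X \<Longrightarrow> \<xi> < \<zeta> \<Longrightarrow>
      (if s then \<not> base_fun \<eta> A (g \<xi>) (g \<zeta>) else \<not> base_fun \<eta> A (g \<zeta>) (g \<xi>))"
  shows False
proof -
  have "g \<xi> \<noteq> g \<zeta>" if "\<xi> \<in> X" "\<zeta> \<in> X" "\<xi> < \<zeta>" for \<xi> \<zeta>
    using un[OF that] base_fun_refl[of \<eta> A "g \<xi>"] by (auto split: if_splits)
  then have inj: "inj_on g X"
    by (intro inj_onI) (metis linorder_neqE)
  obtain Z where Z: "Z \<subseteq> X" "|{..<\<Lambda>}| \<le>o |Z|"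
    "\<And>\<xi> \<zeta>. \<xi> \<in> Z \<Longrightarrow> \<zeta> \<in> Z \<Longrightarrow> block \<Lambda> \<chi> (g \<xi>) \<noteq> block \<Lambda> \<chi> (g \<zeta>) \<Longrightarrow>
      \<xi> < \<zeta> \<longleftrightarrow> g \<xi> < g \<zeta>"
    using increasing_across_blocks[OF X inj] by blast
  have gZ: "g ` Z \<subseteq> {..<\<Lambda>}" using Z(1) X(3) by blast
  have "|g ` Z| =o |{..<\<Lambda>}|"
    by (rule large_image_ordIso[OF Z(2) inj_on_subset[OF inj Z(1)] gZ])
  then obtain \<alpha> \<beta> where ab: "\<alpha> \<in> g ` Z" "\<beta> \<in> g ` Z" "\<alpha> < \<beta>" "common_init (\<eta> \<alpha>) (\<eta> \<beta>) \<in> A"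
    "lex_less (\<eta> \<alpha>) (\<eta> \<beta>) \<longleftrightarrow> (if s then 0 else 1 :: nat) = 0"
    using base gZ unfolding base_plus_def by (metis (no_types, lifting) insertCI)
  have L: "\<alpha> < \<Lambda>" "\<beta> < \<Lambda>" using ab(1,2) gZ by auto
  have rel: "if s then base_fun \<eta> A \<alpha> \<beta> else base_fun \<eta> A \<beta> \<alpha>"
    using related_if_common_init[OF L _ ab(4)] ab(3,5) by (auto split: if_splits)
  then have "block \<Lambda> \<chi> \<alpha> \<noteq> block \<Lambda> \<chi> \<beta>"
    using same_block_unrelated[of \<alpha> \<beta>] same_block_unrelated[of \<beta> \<alpha>] L ab(3) by (auto split: if_splits)
  moreover obtain \<xi> \<zeta> where "\<xi> \<in> Z" "\<zeta> \<in> Z" "\<alpha> = g \<xi>" "\<beta> = g \<zeta>" using ab(1,2) by blast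
  ultimately show False
    using Z(3)[of \<xi> \<zeta>] un[of \<xi> \<zeta>] Z(1) ab(3) rel by (auto split: if_splits)
qed

lemma no_long_left_separated:
  fixes \<kappa> :: "'k rel"
  assumes base: "base_plus \<mu> \<Lambda> \<chi> \<eta> A" and sep: "left_separated algebra \<kappa> a"
  shows "\<not> |{..<\<Lambda>}| \<le>o \<kappa>"
proof
  assume "|{..<\<Lambda>}| \<le>o \<kappa>"
  then obtain h where h: "h ` {..<\<Lambda>} \<subseteq> Field \<kappa>"
    "\<forall>\<zeta><\<Lambda>. \<forall>\<xi><\<zeta>. h \<xi> \<noteq> h \<zeta> \<and> (h \<xi>, h \<zeta>) \<in> \<kappa>"
    by (rule cardinal_embedding[OF Lambda_cardinal])
  have hW: "h \<zeta> \<in> aboveS \<kappa> (h \<xi>)" if "\<xi> < \<Lambda>" "\<zeta> < \<Lambda>" "\<xi> < \<zeta>" for \<xi> \<zeta>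
    using h(2)[rule_format, OF that(2,3)] by (auto simp: aboveS_def)
  from separated_imp_unrelated[OF sep[unfolded left_separated_iff]
      order.trans[OF aboveS_subset Diff_subset] h(1), of "(<)", OF hW]
  obtain X g s where X: "X \<subseteq> {..<\<Lambda>}" "|{..<\<Lambda>}| \<le>o |X|" "g ` X \<subseteq> {..<\<Lambda>}"
    and *: "\<forall>\<xi>\<in>X. \<forall>\<zeta>\<in>X. \<xi> < \<zeta> \<longrightarrow>
      (if s then \<not> base_fun \<eta> A (g \<xi>) (g \<zeta>) else \<not> base_fun \<eta> A (g \<zeta>) (g \<xi>))"
    by blast
  show False by (rule no_monotone_unrelated[OF base X, of s]) (use * in blast)
qed

lemma no_long_right_separated:
  fixes \<kappa> :: "'k rel"
  assumes base: "base_plus \<mu> \<Lambda> \<chi> \<eta> A" and sep: "right_separated algebra \<kappa> a"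
  shows "\<not> |{..<\<Lambda>}| \<le>o \<kappa>"
proof
  assume "|{..<\<Lambda>}| \<le>o \<kappa>"
  then obtain h where h: "h ` {..<\<Lambda>} \<subseteq> Field \<kappa>"
    "\<forall>\<zeta><\<Lambda>. \<forall>\<xi><\<zeta>. h \<xi> \<noteq> h \<zeta> \<and> (h \<xi>, h \<zeta>) \<in> \<kappa>"
    by (rule cardinal_embedding[OF Lambda_cardinal])
  have hW: "h \<zeta> \<in> underS \<kappa> (h \<xi>)" if "\<xi> < \<Lambda>" "\<zeta> < \<Lambda>" "\<zeta> < \<xi>" for \<xi> \<zeta>
    using h(2)[rule_format, OF that(1,3)] by (auto simp: underS_def)
  from separated_imp_unrelated[OF sep[unfolded right_separated_iff]
      order.trans[OF underS_subset Diff_subset] h(1), of "\<lambda>\<xi> \<zeta>. \<zeta> < \<xi>", OF hW]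
  obtain X g s where X: "X \<subseteq> {..<\<Lambda>}" "|{..<\<Lambda>}| \<le>o |X|" "g ` X \<subseteq> {..<\<Lambda>}"
    and *: "\<forall>\<xi>\<in>X. \<forall>\<zeta>\<in>X. \<zeta> < \<xi> \<longrightarrow>
      (if s then \<not> base_fun \<eta> A (g \<xi>) (g \<zeta>) else \<not> base_fun \<eta> A (g \<zeta>) (g \<xi>))"
    by blast
  show False
    by (rule no_monotone_unrelated[OF base X, of "\<not> s"]) (use * in auto)
qed

lemma cardSuc_le_Lambda:
  assumes "Card_order \<kappa>" "\<not> |{..<\<Lambda>}| \<le>o \<kappa>"
  shows "cardSuc \<kappa> \<le>o |{..<\<Lambda>}|"
proof -
  have "\<kappa> <o |{..<\<Lambda>}|"
    using assms not_ordLeq_iff_ordLess[of \<kappa> "|{..<\<Lambda>}|"] by (simp add: card_of_Well_order)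
  then show ?thesis
    using cardSuc_ordLess_ordLeq[OF assms(1) card_of_Card_order] by blast
qed

lemma inj_singleton_Gen: "inj (\<lambda>\<alpha>. {Gen \<alpha>})" "inj (\<lambda>\<alpha>. {{Gen \<alpha>}})"
  by (auto simp: inj_def)

text \<open>
  The generators of the blocks give sequences of length at least \<open>\<chi> i\<close> for all \<open>i\<close>; hence the
  suprema of lengths and of their successors are at least \<open>\<Lambda>\<close>, whatever weakening \<open>S\<close> of
  ideal independence is considered.
\<close>
lemma Sup_lengths:
  fixes S :: "'a bterm set rel \<Rightarrow> bool"
  assumes "\<And>\<kappa>. Card_order \<kappa> \<Longrightarrow> S \<kappa> \<Longrightarrow> \<kappa> \<le>o |{..<\<Lambda>}|"
    and "\<And>\<kappa> a. ideal_independent algebra \<kappa> a \<Longrightarrow> S \<kappa>"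
  shows "card_Sup {\<kappa>. Card_order \<kappa> \<and> S \<kappa>} =o |{..<\<Lambda>}|"
proof (rule card_Sup_eq[OF _ _ _ inj_singleton_Gen(1)])
  fix i assume "i < \<theta>"
  then obtain \<kappa> :: "'a bterm set rel" and a
    where "Card_order \<kappa>" "ideal_independent algebra \<kappa> a" "|{..<\<chi> i}| \<le>o \<kappa>"
    by (rule block_ideal_independent)
  then show "\<exists>\<kappa>\<in>{\<kappa>. Card_order \<kappa> \<and> S \<kappa>}. |{..<\<chi> i}| \<le>o \<kappa>"
    using assms(2) by blast
qed (use assms(1) in auto)

lemma Sup_successors:
  fixes S :: "'a bterm set rel \<Rightarrow> bool"
  assumes short: "\<And>\<kappa>. Card_order \<kappa> \<Longrightarrow> S \<kappa> \<Longrightarrow> \<not> |{..<\<Lambda>}| \<le>o \<kappa>"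
    and long: "\<And>\<kappa> a. ideal_independent algebra \<kappa> a \<Longrightarrow> S \<kappa>"
  shows "card_Sup {cardSuc \<kappa> |\<kappa>. Card_order \<kappa> \<and> S \<kappa>} =o |{..<\<Lambda>}|"
proof (rule card_Sup_eq[OF _ _ _ inj_singleton_Gen(2)])
  fix i assume "i < \<theta>"
  then obtain \<kappa> :: "'a bterm set rel" and a
    where \<kappa>: "Card_order \<kappa>" "ideal_independent algebra \<kappa> a" "|{..<\<chi> i}| \<le>o \<kappa>"
    by (rule block_ideal_independent)
  have "|{..<\<chi> i}| \<le>o cardSuc \<kappa>"
    by (rule ordLeq_transitive[OF \<kappa>(3) ordLess_imp_ordLeq[OF cardSuc_greater[OF \<kappa>(1)]]])
  then show "\<exists>\<kappa>\<in>{cardSuc \<kappa> |\<kappa>. Card_order \<kappa> \<and> S \<kappa>}. |{..<\<chi> i}| \<le>o \<kappa>"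
    using \<kappa>(1) long[OF \<kappa>(2)] by blast
next
  fix \<kappa> assume "\<kappa> \<in> {cardSuc \<kappa> |\<kappa>. Card_order \<kappa> \<and> S \<kappa>}"
  then obtain \<kappa>' where \<kappa>': "\<kappa> = cardSuc \<kappa>'" "Card_order \<kappa>'" "S \<kappa>'" by blast
  show "Card_order \<kappa>" unfolding \<kappa>'(1) by (rule cardSuc_Card_order[OF \<kappa>'(2)])
  show "\<kappa> \<le>o |{..<\<Lambda>}|"
    unfolding \<kappa>'(1) by (rule cardSuc_le_Lambda[OF \<kappa>'(2) short[OF \<kappa>'(2,3)]])
qed

end

theorem theorem6p6:
  fixes \<mu> \<Lambda> :: "'a::wellorder"
    and \<chi> :: "'a \<Rightarrow> 'a"
    and \<eta> :: "'a \<Rightarrow> ('a \<rightharpoonup> 'a)"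
    and A :: "('a \<rightharpoonup> 'a) set"
  assumes "good_parameter \<mu> \<Lambda> \<chi>"
    and "base \<mu> \<Lambda> \<chi> \<eta> A"
  shows "hL_inv (base_algebra \<Lambda> \<eta> A) =o |{..<\<Lambda>}| \<and>
         hd_inv (base_algebra \<Lambda> \<eta> A) =o |{..<\<Lambda>}| \<and>
         s_plus (base_algebra \<Lambda> \<eta> A) =o |{..<\<Lambda>}| \<and>
         (base_plus \<mu> \<Lambda> \<chi> \<eta> A \<longrightarrow>
           hL7_plus (base_algebra \<Lambda> \<eta> A) =o |{..<\<Lambda>}| \<and>
           hd5_plus (base_algebra \<Lambda> \<eta> A) =o |{..<\<Lambda>}| )"
proof -
  interpret branches \<mu> \<Lambda> \<chi> \<eta> A
    using assms by unfold_locales (auto simp: base_def)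
  have "hL_inv algebra =o |{..<\<Lambda>}|"
    unfolding hL_inv_def
  proof (rule Sup_lengths)
    fix \<kappa> :: "'a bterm set rel"
    assume "Card_order \<kappa>" "\<exists>a. right_separated algebra \<kappa> a"
    then show "\<kappa> \<le>o |{..<\<Lambda>}|"
      unfolding right_separated_iff base_algebra_def
      by (elim exE) (rule separated_length[OF _ _ Lambda_infinite Card_order_total(2)])
  qed (use ideal_independent_imp_right_separated in blast)
  moreover have "hd_inv algebra =o |{..<\<Lambda>}|"
    unfolding hd_inv_def
  proof (rule Sup_lengths)
    fix \<kappa> :: "'a bterm set rel"
    assume "Card_order \<kappa>" "\<exists>a. left_separated algebra \<kappa> a"
    then show "\<kappa> \<le>o |{..<\<Lambda>}|"
      unfolding left_separated_iff base_algebra_def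
      by (elim exE) (rule separated_length[OF _ _ Lambda_infinite Card_order_total(1)])
  qed (use ideal_independent_imp_left_separated in blast)
  moreover have "s_plus algebra =o |{..<\<Lambda>}|"
    unfolding s_plus_def using no_long_ideal_independent[OF assms(2)]
    by (intro Sup_successors) blast+
  moreover have "hL7_plus algebra =o |{..<\<Lambda>}|" if "base_plus \<mu> \<Lambda> \<chi> \<eta> A"
    unfolding hL7_plus_def
    using no_long_right_separated[OF that] ideal_independent_imp_right_separated
    by (intro Sup_successors) blast+
  moreover have "hd5_plus algebra =o |{..<\<Lambda>}|" if "base_plus \<mu> \<Lambda> \<chi> \<eta> A"
    unfolding hd5_plus_def
    using no_long_left_separated[OF that] ideal_independent_imp_left_separated
    by (intro Sup_successors) blast+
  ultimately show ?thesis by blast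
qed

end
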